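(* The categories $\mathcal{C}^{b,b}_{\lambda,\varsigma}(+,1,1)$, $\mathcal{C}^{0,0}_{\lambda,\varsigma}(+,1,1)$ and $\mathcal{C}^{0,0}_{-\lambda,\varsigma}(-,1,1)$ are each their own monoidal opposite (i.e. isomorphic, as strict monoidal supercategories, to their monoidal opposite), while the categories $\mathcal{C}^{b,0}_{b-\lambda,\varsigma}(-,1,1)$ and $\mathcal{C}^{0,b}_{b-\lambda,\varsigma}(-,1,1)$ are each other's monoidal opposites (i.e. each is isomorphic to the monoidal opposite of the other).
   Context: $\mathbb{K}$ is a field of characteristic different from 2; everything is $\mathbb{K}$-linear. A strict monoidal supercategory is a strict monoidal category enriched over $\mathbb{Z}/2$-graded vector spaces, with interchange law $(f\otimes g)\circ(h\otimes k)=(-1)^{|g||h|}(f\circ h)\otimes(g\circ k)$. The monoidal opposite $(\mathcal{C}^{\mathrm{op}},\otimes^{\mathrm{op}})$ of $(\mathcal{C},\otimes)$ has the same underlying category $\mathcal{C}$, and tensor product with the factors reversed: $f\otimes^{\mathrm{op}}g=(-1)^{|f||g|}g\otimes f$. All categories in the claim are the strict monoidal supercategories with one generating object $\bullet$ ($m$ denotes $\bullet^{\otimes m}$, $I$ the identity of $\bullet$, $1_2$ the identity of $\bullet^{\otimes2}$) and generating morphisms $H\in\mathrm{Hom}(2,2)$ (even, invertible), $A\in\mathrm{Hom}(2,0)$, $U\in\mathrm{Hom}(0,2)$ ($A,U$ even for sign $+$, odd for sign $-$), subject to the defining relations: $HU=\lambda U$, $AH=\lambda'A$; $AU=\delta$;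 $(A\otimes I)(I\otimes U)=\varsigma I$, $(I\otimes A)(U\otimes I)=\varsigma' I$; $(A\otimes I)(I\otimes H)(U\otimes I)=\rho I$; $H^2=a1_2+bH+cUA$; $(H\otimes I)(I\otimes U)=d(U\otimes I)+e(I\otimes H)(U\otimes I)+f(I\otimes U)$; $(H\otimes I)(I\otimes H)(U\otimes I)=D(U\otimes I)+E(I\otimes H)(U\otimes I)+F(I\otimes U)$; $(I\otimes A)(H\otimes I)=d'(A\otimes I)+e'(A\otimes I)(I\otimes H)+f'(I\otimes A)$; $(A\otimes I)(I\otimes H)(H\otimes I)=D'(A\otimes I)+E'(A\otimes I)(I\otimes H)+F'(I\otimes A)$; $(H\otimes I)(I\otimes H)(H\otimes I)=(I\otimes H)(H\otimes I)(I\otimes H)$. In all five categories $e=e'=1$, $\lambda,\varsigma$ are non-zero, and $a\neq0$. The other parameter values are: $\mathcal{C}^{b,b}_{\lambda,\varsigma}(+,1,1)$: $b\neq0$, $\delta$ arbitrary, $\lambda'=\lambda$, $a=\lambda^2-b\lambda+b\lambda\delta/\varsigma$, $c=-b\lambda/\varsigma$, $\varsigma'=\varsigma$, $\rho=\varsigma(\lambda-b)+b\delta$, $d=d'=-b$, $f=f'=b$, $D=E=D'=E'=0$, $F=F'=a$. $\mathcal{C}^{0,0}_{\lambda,\varsigma}(+,1,1)$: $\delta$ arbitrary, $\lambda'=\lambda$, $a=\lambda^2$, $b=c=0$, $\varsigma'=\varsigma$, $\rho=\varsigma\lambda$, $d=d'=f=f'=D=E=D'=E'=0$, $F=F'=\lambda^2$.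 $\mathcal{C}^{0,0}_{-\lambda,\varsigma}(-,1,1)$: $\lambda'=-\lambda$, $\delta=0$, $a=\lambda^2$, $b=c=0$, $\varsigma'=-\varsigma$, $\rho=-\varsigma\lambda$, $d=d'=f=f'=D=E=D'=E'=0$, $F=F'=\lambda^2$. $\mathcal{C}^{b,0}_{b-\lambda,\varsigma}(-,1,1)$: $b\ne0$, $\lambda'=b-\lambda$, $\delta=0$, $a=\lambda^2-b\lambda$, $c=0$, $\varsigma'=-\varsigma$, $\rho=-\varsigma\lambda$, $d=0$, $d'=-b$, $f=b$, $f'=0$, $D=E=0$, $D'=-b\lambda$, $E'=b$, $F=F'=a$. $\mathcal{C}^{0,b}_{b-\lambda,\varsigma}(-,1,1)$: $b\ne0$, $\lambda'=b-\lambda$, $\delta=0$, $a=\lambda^2-b\lambda$, $c=0$, $\varsigma'=-\varsigma$, $\rho=-\varsigma(\lambda-b)$, $d=-b$, $d'=0$, $f=0$, $f'=b$, $D=b(\lambda-b)$, $E=b$, $D'=E'=0$, $F=F'=a$. In the claim, the values of the independent parameters ($\lambda,\varsigma$, and $b,\delta$ where applicable) are the same on both sides. *)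

theory Defs
  imports "HOL-Algebra.Algebraic_Closure_Type" "HOL-Library.Z2"
begin

section \<open>Strict monoidal supercategories\<close>

text \<open>
  A \<open>\<int>/2\<close>-graded vector space is given by its pair of homogeneous components, indexed by
  \<^typ>\<open>bit\<close>, and only homogeneous morphisms are considered as arrows. The bilinear
  operations are determined by their values on homogeneous arguments, and the graded morphism
  space from \<open>x\<close> to \<open>y\<close> is the direct sum of \<open>Hom C x y 0\<close> and \<open>Hom C x y 1\<close>. The objects
  are all the elements of the type \<^typ>\<open>'o\<close>. Every arrow has a source, a target and
  a parity, so that in particular each \<open>Hom C x y p\<close> has its own zero.
  \<open>Cmp C f g\<close> is the composite ``\<open>f\<close> after \<open>g\<close>''.
\<close>

record ('o, 'm, 'k) supercat =
  Arr  :: "'m set"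
  Src  :: "'m \<Rightarrow> 'o"
  Tgt  :: "'m \<Rightarrow> 'o"
  Par  :: "'m \<Rightarrow> bit"
  Zer  :: "'o \<Rightarrow> 'o \<Rightarrow> bit \<Rightarrow> 'm"
  Add  :: "'m \<Rightarrow> 'm \<Rightarrow> 'm"
  Scl  :: "'k \<Rightarrow> 'm \<Rightarrow> 'm"
  Ide  :: "'o \<Rightarrow> 'm"
  Cmp  :: "'m \<Rightarrow> 'm \<Rightarrow> 'm"
  UntO :: 'o
  TnsO :: "'o \<Rightarrow> 'o \<Rightarrow> 'o"
  Tns  :: "'m \<Rightarrow> 'm \<Rightarrow> 'm"

definition Hom :: "('o, 'm, 'k) supercat \<Rightarrow> 'o \<Rightarrow> 'o \<Rightarrow> bit \<Rightarrow> 'm set" where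
  "Hom C x y p = {f \<in> Arr C. Src C f = x \<and> Tgt C f = y \<and> Par C f = p}"

text \<open>
  The vector space \<open>Hom C x y p\<close> as a module record of HOL-Algebra; the ring multiplication and
  unit contained in such a record play no role in the locale \<^locale>\<open>module\<close>.
\<close>

definition Hom_space ::
    "('o, 'm, 'k) supercat \<Rightarrow> 'o \<Rightarrow> 'o \<Rightarrow> bit \<Rightarrow> ('k, 'm) module" where
  "Hom_space C x y p =
     \<lparr>carrier = Hom C x y p, monoid.mult = undefined, monoid.one = undefined,
      ring.zero = Zer C x y p, ring.add = Add C, module.smult = Scl C\<rparr>"

text \<open>The Koszul sign \<open>(-1)\<^sup>p\<close>.\<close>

definition ksign :: "bit \<Rightarrow> 'k::field" where
  "ksign p = (if p = 0 then 1 else - 1)"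

locale strict_monoidal_supercategory =
  fixes C :: "('o, 'm, 'k::field) supercat"
  assumes vector_space: "module (ring_of_type_algebra :: 'k ring) (Hom_space C x y p)"
    and Ide_in: "Ide C x \<in> Hom C x x 0"
    and Cmp_in: "f \<in> Hom C y z p \<Longrightarrow> g \<in> Hom C x y q \<Longrightarrow> Cmp C f g \<in> Hom C x z (p + q)"
    and Cmp_Ide: "f \<in> Hom C x y p \<Longrightarrow> Cmp C f (Ide C x) = f"
    and Ide_Cmp: "f \<in> Hom C x y p \<Longrightarrow> Cmp C (Ide C y) f = f"
    and Cmp_assoc: "f \<in> Hom C z w p \<Longrightarrow> g \<in> Hom C y z q \<Longrightarrow> h \<in> Hom C x y r \<Longrightarrow>
        Cmp C (Cmp C f g) h = Cmp C f (Cmp C g h)"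
    and Cmp_Add_left: "f \<in> Hom C y z p \<Longrightarrow> f' \<in> Hom C y z p \<Longrightarrow> g \<in> Hom C x y q \<Longrightarrow>
        Cmp C (Add C f f') g = Add C (Cmp C f g) (Cmp C f' g)"
    and Cmp_Add_right: "f \<in> Hom C y z p \<Longrightarrow> g \<in> Hom C x y q \<Longrightarrow> g' \<in> Hom C x y q \<Longrightarrow>
        Cmp C f (Add C g g') = Add C (Cmp C f g) (Cmp C f g')"
    and Cmp_Scl_left: "f \<in> Hom C y z p \<Longrightarrow> g \<in> Hom C x y q \<Longrightarrow>
        Cmp C (Scl C k f) g = Scl C k (Cmp C f g)"
    and Cmp_Scl_right: "f \<in> Hom C y z p \<Longrightarrow> g \<in> Hom C x y q \<Longrightarrow>
        Cmp C f (Scl C k g) = Scl C k (Cmp C f g)"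
    and TnsO_assoc: "TnsO C (TnsO C x y) z = TnsO C x (TnsO C y z)"
    and TnsO_unit_left: "TnsO C (UntO C) x = x"
    and TnsO_unit_right: "TnsO C x (UntO C) = x"
    and Tns_in: "f \<in> Hom C x y p \<Longrightarrow> g \<in> Hom C x' y' q \<Longrightarrow>
        Tns C f g \<in> Hom C (TnsO C x x') (TnsO C y y') (p + q)"
    and Tns_Ide: "Tns C (Ide C x) (Ide C y) = Ide C (TnsO C x y)"
    and Tns_assoc: "f \<in> Hom C x y p \<Longrightarrow> g \<in> Hom C x' y' q \<Longrightarrow> h \<in> Hom C x'' y'' r \<Longrightarrow>
        Tns C (Tns C f g) h = Tns C f (Tns C g h)"
    and Tns_unit_left: "f \<in> Hom C x y p \<Longrightarrow> Tns C (Ide C (UntO C)) f = f"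
    and Tns_unit_right: "f \<in> Hom C x y p \<Longrightarrow> Tns C f (Ide C (UntO C)) = f"
    and Tns_Add_left: "f \<in> Hom C x y p \<Longrightarrow> f' \<in> Hom C x y p \<Longrightarrow> g \<in> Hom C x' y' q \<Longrightarrow>
        Tns C (Add C f f') g = Add C (Tns C f g) (Tns C f' g)"
    and Tns_Add_right: "f \<in> Hom C x y p \<Longrightarrow> g \<in> Hom C x' y' q \<Longrightarrow> g' \<in> Hom C x' y' q \<Longrightarrow>
        Tns C f (Add C g g') = Add C (Tns C f g) (Tns C f g')"
    and Tns_Scl_left: "f \<in> Hom C x y p \<Longrightarrow> g \<in> Hom C x' y' q \<Longrightarrow>
        Tns C (Scl C k f) g = Scl C k (Tns C f g)"
    and Tns_Scl_right: "f \<in> Hom C x y p \<Longrightarrow> g \<in> Hom C x' y' q \<Longrightarrow>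
        Tns C f (Scl C k g) = Scl C k (Tns C f g)"
    and super_interchange:
      "f \<in> Hom C y z p \<Longrightarrow> g \<in> Hom C y' z' q \<Longrightarrow> h \<in> Hom C x y r \<Longrightarrow> h' \<in> Hom C x' y' s \<Longrightarrow>
        Cmp C (Tns C f g) (Tns C h h') = Scl C (ksign (q * r)) (Tns C (Cmp C f h) (Cmp C g h'))"

definition monoidal_op :: "('o, 'm, 'k::field) supercat \<Rightarrow> ('o, 'm, 'k) supercat" where
  "monoidal_op C = C\<lparr>TnsO := (\<lambda>x y. TnsO C y x),
     Tns := (\<lambda>f g. Scl C (ksign (Par C f * Par C g)) (Tns C g f))\<rparr>"

locale strict_monoidal_superfunctor =
  C: strict_monoidal_supercategory C + D: strict_monoidal_supercategory D
  for C :: "('o, 'm, 'k::field) supercat" and D :: "('o', 'm', 'k) supercat" +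
  fixes Fo :: "'o \<Rightarrow> 'o'" and Fm :: "'m \<Rightarrow> 'm'"
  assumes Fm_in: "f \<in> Hom C x y p \<Longrightarrow> Fm f \<in> Hom D (Fo x) (Fo y) p"
    and Fm_Add: "f \<in> Hom C x y p \<Longrightarrow> g \<in> Hom C x y p \<Longrightarrow> Fm (Add C f g) = Add D (Fm f) (Fm g)"
    and Fm_Scl: "f \<in> Hom C x y p \<Longrightarrow> Fm (Scl C k f) = Scl D k (Fm f)"
    and Fm_Ide: "Fm (Ide C x) = Ide D (Fo x)"
    and Fm_Cmp: "f \<in> Hom C y z p \<Longrightarrow> g \<in> Hom C x y q \<Longrightarrow> Fm (Cmp C f g) = Cmp D (Fm f) (Fm g)"
    and Fo_unit: "Fo (UntO C) = UntO D"
    and Fo_TnsO: "Fo (TnsO C x y) = TnsO D (Fo x) (Fo y)"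
    and Fm_Tns: "f \<in> Hom C x y p \<Longrightarrow> g \<in> Hom C x' y' q \<Longrightarrow>
        Fm (Tns C f g) = Tns D (Fm f) (Fm g)"

definition isomorphic_supercat ::
    "('o, 'm, 'k::field) supercat \<Rightarrow> ('o', 'm', 'k) supercat \<Rightarrow> bool" (infix "\<cong>\<^sub>s" 50) where
  "C \<cong>\<^sub>s D \<longleftrightarrow> (\<exists>Fo Fm. strict_monoidal_superfunctor C D Fo Fm \<and> bij Fo \<and>
     (\<forall>x y p. bij_betw Fm (Hom C x y p) (Hom D (Fo x) (Fo y) p)))"


section \<open>Presentations with one generating object\<close>

text \<open>
  Objects are the tensor powers of the generating object, i.e. natural numbers. Morphisms are
  formal expressions in the generating morphisms modulo the smallest congruence
  containing the axioms of a strict monoidal supercategory and the given relations.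
\<close>

record 'g signature =
  gdom :: "'g \<Rightarrow> nat"
  gcod :: "'g \<Rightarrow> nat"
  gpar :: "'g \<Rightarrow> bit"

datatype ('g, 'k) trm =
    TGen 'g
  | TId nat
  | TZero nat nat bit
  | TCmp "('g, 'k) trm" "('g, 'k) trm"  (infixr "\<cdot>" 75)
  | TTns "('g, 'k) trm" "('g, 'k) trm"  (infixr "\<boxtimes>" 80)
  | TAdd "('g, 'k) trm" "('g, 'k) trm"  (infixl "\<boxplus>" 65)
  | TScl 'k "('g, 'k) trm"              (infixr "\<star>" 70)

primrec tdom :: "'g signature \<Rightarrow> ('g, 'k) trm \<Rightarrow> nat" where
  "tdom S (TGen x) = gdom S x"
| "tdom S (TId m) = m"
| "tdom S (TZero m n p) = m"
| "tdom S (f \<cdot> g) = tdom S g"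
| "tdom S (f \<boxtimes> g) = tdom S f + tdom S g"
| "tdom S (f \<boxplus> g) = tdom S f"
| "tdom S (k \<star> f) = tdom S f"

primrec tcod :: "'g signature \<Rightarrow> ('g, 'k) trm \<Rightarrow> nat" where
  "tcod S (TGen x) = gcod S x"
| "tcod S (TId m) = m"
| "tcod S (TZero m n p) = n"
| "tcod S (f \<cdot> g) = tcod S f"
| "tcod S (f \<boxtimes> g) = tcod S f + tcod S g"
| "tcod S (f \<boxplus> g) = tcod S f"
| "tcod S (k \<star> f) = tcod S f"

primrec tpar :: "'g signature \<Rightarrow> ('g, 'k) trm \<Rightarrow> bit" where
  "tpar S (TGen x) = gpar S x"
| "tpar S (TId m) = 0"
| "tpar S (TZero m n p) = p"
| "tpar S (f \<cdot> g) = tpar S f + tpar S g"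
| "tpar S (f \<boxtimes> g) = tpar S f + tpar S g"
| "tpar S (f \<boxplus> g) = tpar S f"
| "tpar S (k \<star> f) = tpar S f"

definition parallel :: "'g signature \<Rightarrow> ('g, 'k) trm \<Rightarrow> ('g, 'k) trm \<Rightarrow> bool" where
  "parallel S f g \<longleftrightarrow> tdom S f = tdom S g \<and> tcod S f = tcod S g \<and> tpar S f = tpar S g"

primrec wt :: "'g signature \<Rightarrow> ('g, 'k) trm \<Rightarrow> bool" where
  "wt S (TGen x) \<longleftrightarrow> True"
| "wt S (TId m) \<longleftrightarrow> True"
| "wt S (TZero m n p) \<longleftrightarrow> True"
| "wt S (f \<cdot> g) \<longleftrightarrow> wt S f \<and> wt S g \<and> tdom S f = tcod S g"
| "wt S (f \<boxtimes> g) \<longleftrightarrow> wt S f \<and> wt S g"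
| "wt S (f \<boxplus> g) \<longleftrightarrow> wt S f \<and> wt S g \<and> parallel S f g"
| "wt S (k \<star> f) \<longleftrightarrow> wt S f"

inductive trm_eq :: "'g signature \<Rightarrow> (('g, 'k::field) trm \<times> ('g, 'k) trm) set \<Rightarrow>
    ('g, 'k) trm \<Rightarrow> ('g, 'k) trm \<Rightarrow> bool"
  for S :: "'g signature" and R :: "(('g, 'k::field) trm \<times> ('g, 'k) trm) set" where
  rel: "(f, g) \<in> R \<Longrightarrow> wt S f \<Longrightarrow> wt S g \<Longrightarrow> parallel S f g \<Longrightarrow> trm_eq S R f g"
| refl: "wt S f \<Longrightarrow> trm_eq S R f f"
| sym: "trm_eq S R f g \<Longrightarrow> trm_eq S R g f"
| trans: "trm_eq S R f g \<Longrightarrow> trm_eq S R g h \<Longrightarrow> trm_eq S R f h"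
| cong_cmp: "trm_eq S R f f' \<Longrightarrow> trm_eq S R g g' \<Longrightarrow> tdom S f = tcod S g \<Longrightarrow>
    trm_eq S R (f \<cdot> g) (f' \<cdot> g')"
| cong_tns: "trm_eq S R f f' \<Longrightarrow> trm_eq S R g g' \<Longrightarrow> trm_eq S R (f \<boxtimes> g) (f' \<boxtimes> g')"
| cong_add: "trm_eq S R f f' \<Longrightarrow> trm_eq S R g g' \<Longrightarrow> parallel S f g \<Longrightarrow> trm_eq S R (f \<boxplus> g) (f' \<boxplus> g')"
| cong_scl: "trm_eq S R f f' \<Longrightarrow> trm_eq S R (k \<star> f) (k \<star> f')"
| add_assoc: "wt S ((f \<boxplus> g) \<boxplus> h) \<Longrightarrow> trm_eq S R ((f \<boxplus> g) \<boxplus> h) (f \<boxplus> (g \<boxplus> h))"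
| add_commute: "wt S (f \<boxplus> g) \<Longrightarrow> trm_eq S R (f \<boxplus> g) (g \<boxplus> f)"
| add_zero: "wt S f \<Longrightarrow> trm_eq S R (TZero (tdom S f) (tcod S f) (tpar S f) \<boxplus> f) f"
| add_minus: "wt S f \<Longrightarrow>
    trm_eq S R (((- 1) \<star> f) \<boxplus> f) (TZero (tdom S f) (tcod S f) (tpar S f))"
| scl_add: "wt S (f \<boxplus> g) \<Longrightarrow> trm_eq S R (k \<star> (f \<boxplus> g)) (k \<star> f \<boxplus> k \<star> g)"
| add_scl: "wt S f \<Longrightarrow> trm_eq S R ((k + l) \<star> f) (k \<star> f \<boxplus> l \<star> f)"
| scl_scl: "wt S f \<Longrightarrow> trm_eq S R ((k * l) \<star> f) (k \<star> l \<star> f)"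
| scl_one: "wt S f \<Longrightarrow> trm_eq S R (1 \<star> f) f"
| cmp_assoc: "wt S ((f \<cdot> g) \<cdot> h) \<Longrightarrow> trm_eq S R ((f \<cdot> g) \<cdot> h) (f \<cdot> (g \<cdot> h))"
| cmp_id: "wt S f \<Longrightarrow> trm_eq S R (f \<cdot> TId (tdom S f)) f"
| id_cmp: "wt S f \<Longrightarrow> trm_eq S R (TId (tcod S f) \<cdot> f) f"
| cmp_add_left: "wt S ((f \<boxplus> f') \<cdot> g) \<Longrightarrow> trm_eq S R ((f \<boxplus> f') \<cdot> g) (f \<cdot> g \<boxplus> f' \<cdot> g)"
| cmp_add_right: "wt S (f \<cdot> (g \<boxplus> g')) \<Longrightarrow> trm_eq S R (f \<cdot> (g \<boxplus> g')) (f \<cdot> g \<boxplus> f \<cdot> g')"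
| cmp_scl_left: "wt S (f \<cdot> g) \<Longrightarrow> trm_eq S R ((k \<star> f) \<cdot> g) (k \<star> (f \<cdot> g))"
| cmp_scl_right: "wt S (f \<cdot> g) \<Longrightarrow> trm_eq S R (f \<cdot> (k \<star> g)) (k \<star> (f \<cdot> g))"
| tns_assoc: "wt S ((f \<boxtimes> g) \<boxtimes> h) \<Longrightarrow> trm_eq S R ((f \<boxtimes> g) \<boxtimes> h) (f \<boxtimes> (g \<boxtimes> h))"
| tns_unit_left: "wt S f \<Longrightarrow> trm_eq S R (TId 0 \<boxtimes> f) f"
| tns_unit_right: "wt S f \<Longrightarrow> trm_eq S R (f \<boxtimes> TId 0) f"
| tns_id: "trm_eq S R (TId m \<boxtimes> TId n) (TId (m + n))"
| tns_add_left: "wt S ((f \<boxplus> f') \<boxtimes> g) \<Longrightarrow> trm_eq S R ((f \<boxplus> f') \<boxtimes> g) (f \<boxtimes> g \<boxplus> f' \<boxtimes> g)"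
| tns_add_right: "wt S (f \<boxtimes> (g \<boxplus> g')) \<Longrightarrow> trm_eq S R (f \<boxtimes> (g \<boxplus> g')) (f \<boxtimes> g \<boxplus> f \<boxtimes> g')"
| tns_scl_left: "wt S (f \<boxtimes> g) \<Longrightarrow> trm_eq S R ((k \<star> f) \<boxtimes> g) (k \<star> (f \<boxtimes> g))"
| tns_scl_right: "wt S (f \<boxtimes> g) \<Longrightarrow> trm_eq S R (f \<boxtimes> (k \<star> g)) (k \<star> (f \<boxtimes> g))"
| interchange: "wt S f \<Longrightarrow> wt S g \<Longrightarrow> wt S h \<Longrightarrow> wt S k \<Longrightarrow>
    tdom S f = tcod S h \<Longrightarrow> tdom S g = tcod S k \<Longrightarrow>
    trm_eq S R ((f \<boxtimes> g) \<cdot> (h \<boxtimes> k)) (ksign (tpar S g * tpar S h) \<star> ((f \<cdot> h) \<boxtimes> (g \<cdot> k)))"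

definition cls :: "'g signature \<Rightarrow> (('g, 'k::field) trm \<times> ('g, 'k) trm) set \<Rightarrow>
    ('g, 'k) trm \<Rightarrow> ('g, 'k) trm set" where
  "cls S R f = {g. trm_eq S R f g}"

definition rep :: "'a set \<Rightarrow> 'a" where
  "rep W = (SOME x. x \<in> W)"

definition presented :: "'g signature \<Rightarrow> (('g, 'k::field) trm \<times> ('g, 'k) trm) set \<Rightarrow>
    (nat, ('g, 'k) trm set, 'k) supercat" where
  "presented S R =
     \<lparr>Arr = {cls S R f |f. wt S f},
      Src = (\<lambda>W. tdom S (rep W)), Tgt = (\<lambda>W. tcod S (rep W)), Par = (\<lambda>W. tpar S (rep W)),
      Zer = (\<lambda>m n p. cls S R (TZero m n p)),
      Add = (\<lambda>W Y. cls S R (rep W \<boxplus> rep Y)),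
      Scl = (\<lambda>k W. cls S R (k \<star> rep W)),
      Ide = (\<lambda>m. cls S R (TId m)),
      Cmp = (\<lambda>W Y. cls S R (rep W \<cdot> rep Y)),
      UntO = 0, TnsO = (+),
      Tns = (\<lambda>W Y. cls S R (rep W \<boxtimes> rep Y))\<rparr>"


section \<open>The categories \<open>\<C>\<close>\<close>

datatype gen = gH | gHinv | gA | gU

definition gen_sig :: "bit \<Rightarrow> gen signature" where
  "gen_sig s =
     \<lparr>gdom = (\<lambda>x. case x of gH \<Rightarrow> 2 | gHinv \<Rightarrow> 2 | gA \<Rightarrow> 2 | gU \<Rightarrow> 0),
      gcod = (\<lambda>x. case x of gH \<Rightarrow> 2 | gHinv \<Rightarrow> 2 | gA \<Rightarrow> 0 | gU \<Rightarrow> 2),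
      gpar = (\<lambda>x. case x of gH \<Rightarrow> 0 | gHinv \<Rightarrow> 0 | gA \<Rightarrow> s | gU \<Rightarrow> s)\<rparr>"

text \<open>
  The field \<open>p_sign\<close> is the parity of the generators \<open>A\<close> and \<open>U\<close>: it is \<open>0\<close> for the sign \<open>+\<close>
  and \<open>1\<close> for the sign \<open>-\<close>.
\<close>

record 'k params =
  p_sign :: bit
  p_lam :: 'k  p_lam' :: 'k
  p_delta :: 'k
  p_vs :: 'k  p_vs' :: 'k
  p_rho :: 'k
  p_a :: 'k  p_b :: 'k  p_c :: 'k
  p_d :: 'k  p_e :: 'k  p_f :: 'k
  p_D :: 'k  p_E :: 'k  p_F :: 'k
  p_d' :: 'k  p_e' :: 'k  p_f' :: 'k
  p_D' :: 'k  p_E' :: 'k  p_F' :: 'k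

abbreviation (input) tH :: "(gen, 'k) trm" where "tH \<equiv> TGen gH"
abbreviation (input) tHinv :: "(gen, 'k) trm" where "tHinv \<equiv> TGen gHinv"
abbreviation (input) tA :: "(gen, 'k) trm" where "tA \<equiv> TGen gA"
abbreviation (input) tU :: "(gen, 'k) trm" where "tU \<equiv> TGen gU"
abbreviation (input) tI :: "(gen, 'k) trm" where "tI \<equiv> TId 1"

text \<open>
  The first two relations say that \<open>H\<close> is invertible. \<open>\<boxtimes>\<close> binds most tightly, then composition
  \<open>\<cdot>\<close>, then scalar multiplication \<open>\<star>\<close>, then addition \<open>\<boxplus>\<close>.
\<close>

definition relations :: "'k::field params \<Rightarrow> ((gen, 'k) trm \<times> (gen, 'k) trm) set" where
  "relations P =
    {(tH \<cdot> tHinv, TId 2),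
     (tHinv \<cdot> tH, TId 2),
     (tH \<cdot> tU, p_lam P \<star> tU),
     (tA \<cdot> tH, p_lam' P \<star> tA),
     (tA \<cdot> tU, p_delta P \<star> TId 0),
     (tA \<boxtimes> tI \<cdot> tI \<boxtimes> tU, p_vs P \<star> tI),
     (tI \<boxtimes> tA \<cdot> tU \<boxtimes> tI, p_vs' P \<star> tI),
     (tA \<boxtimes> tI \<cdot> tI \<boxtimes> tH \<cdot> tU \<boxtimes> tI, p_rho P \<star> tI),
     (tH \<cdot> tH, p_a P \<star> TId 2 \<boxplus> p_b P \<star> tH \<boxplus> p_c P \<star> tU \<cdot> tA),
     (tH \<boxtimes> tI \<cdot> tI \<boxtimes> tU,
        p_d P \<star> tU \<boxtimes> tI \<boxplus> p_e P \<star> tI \<boxtimes> tH \<cdot> tU \<boxtimes> tI \<boxplus> p_f P \<star> tI \<boxtimes> tU),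
     (tH \<boxtimes> tI \<cdot> tI \<boxtimes> tH \<cdot> tU \<boxtimes> tI,
        p_D P \<star> tU \<boxtimes> tI \<boxplus> p_E P \<star> tI \<boxtimes> tH \<cdot> tU \<boxtimes> tI \<boxplus> p_F P \<star> tI \<boxtimes> tU),
     (tI \<boxtimes> tA \<cdot> tH \<boxtimes> tI,
        p_d' P \<star> tA \<boxtimes> tI \<boxplus> p_e' P \<star> tA \<boxtimes> tI \<cdot> tI \<boxtimes> tH \<boxplus> p_f' P \<star> tI \<boxtimes> tA),
     (tA \<boxtimes> tI \<cdot> tI \<boxtimes> tH \<cdot> tH \<boxtimes> tI,
        p_D' P \<star> tA \<boxtimes> tI \<boxplus> p_E' P \<star> tA \<boxtimes> tI \<cdot> tI \<boxtimes> tH \<boxplus> p_F' P \<star> tI \<boxtimes> tA),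
     (tH \<boxtimes> tI \<cdot> tI \<boxtimes> tH \<cdot> tH \<boxtimes> tI, tI \<boxtimes> tH \<cdot> tH \<boxtimes> tI \<cdot> tI \<boxtimes> tH)}"

type_synonym 'k gen_supercat = "(nat, (gen, 'k) trm set, 'k) supercat"

definition supercat_of :: "'k::field params \<Rightarrow> 'k gen_supercat" where
  "supercat_of P = presented (gen_sig (p_sign P)) (relations P)"

text \<open>\<open>\<C>\<^bsup>b,b\<^esup>\<^bsub>\<lambda>,\<varsigma>\<^esub>(+,1,1)\<close>\<close>

definition params_bb_plus :: "'k::field \<Rightarrow> 'k \<Rightarrow> 'k \<Rightarrow> 'k \<Rightarrow> 'k params" where
  "params_bb_plus b lam vs delta =
    \<lparr>p_sign = 0, p_lam = lam, p_lam' = lam, p_delta = delta, p_vs = vs, p_vs' = vs,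
     p_rho = vs * (lam - b) + b * delta,
     p_a = lam^2 - b * lam + b * lam * delta / vs, p_b = b, p_c = - (b * lam / vs),
     p_d = - b, p_e = 1, p_f = b,
     p_D = 0, p_E = 0, p_F = lam^2 - b * lam + b * lam * delta / vs,
     p_d' = - b, p_e' = 1, p_f' = b,
     p_D' = 0, p_E' = 0, p_F' = lam^2 - b * lam + b * lam * delta / vs\<rparr>"

text \<open>\<open>\<C>\<^bsup>0,0\<^esup>\<^bsub>\<lambda>,\<varsigma>\<^esub>(+,1,1)\<close>\<close>

definition params_00_plus :: "'k::field \<Rightarrow> 'k \<Rightarrow> 'k \<Rightarrow> 'k params" where
  "params_00_plus lam vs delta =
    \<lparr>p_sign = 0, p_lam = lam, p_lam' = lam, p_delta = delta, p_vs = vs, p_vs' = vs,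
     p_rho = vs * lam,
     p_a = lam^2, p_b = 0, p_c = 0,
     p_d = 0, p_e = 1, p_f = 0,
     p_D = 0, p_E = 0, p_F = lam^2,
     p_d' = 0, p_e' = 1, p_f' = 0,
     p_D' = 0, p_E' = 0, p_F' = lam^2\<rparr>"

text \<open>\<open>\<C>\<^bsup>0,0\<^esup>\<^bsub>-\<lambda>,\<varsigma>\<^esub>(-,1,1)\<close>\<close>

definition params_00_minus :: "'k::field \<Rightarrow> 'k \<Rightarrow> 'k params" where
  "params_00_minus lam vs =
    \<lparr>p_sign = 1, p_lam = lam, p_lam' = - lam, p_delta = 0, p_vs = vs, p_vs' = - vs,
     p_rho = - (vs * lam),
     p_a = lam^2, p_b = 0, p_c = 0,
     p_d = 0, p_e = 1, p_f = 0,
     p_D = 0, p_E = 0, p_F = lam^2,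
     p_d' = 0, p_e' = 1, p_f' = 0,
     p_D' = 0, p_E' = 0, p_F' = lam^2\<rparr>"

text \<open>\<open>\<C>\<^bsup>b,0\<^esup>\<^bsub>b-\<lambda>,\<varsigma>\<^esub>(-,1,1)\<close>\<close>

definition params_b0_minus :: "'k::field \<Rightarrow> 'k \<Rightarrow> 'k \<Rightarrow> 'k params" where
  "params_b0_minus b lam vs =
    \<lparr>p_sign = 1, p_lam = lam, p_lam' = b - lam, p_delta = 0, p_vs = vs, p_vs' = - vs,
     p_rho = - (vs * lam),
     p_a = lam^2 - b * lam, p_b = b, p_c = 0,
     p_d = 0, p_e = 1, p_f = b,
     p_D = 0, p_E = 0, p_F = lam^2 - b * lam,
     p_d' = - b, p_e' = 1, p_f' = 0,
     p_D' = - (b * lam), p_E' = b, p_F' = lam^2 - b * lam\<rparr>"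

text \<open>\<open>\<C>\<^bsup>0,b\<^esup>\<^bsub>b-\<lambda>,\<varsigma>\<^esub>(-,1,1)\<close>\<close>

definition params_0b_minus :: "'k::field \<Rightarrow> 'k \<Rightarrow> 'k \<Rightarrow> 'k params" where
  "params_0b_minus b lam vs =
    \<lparr>p_sign = 1, p_lam = lam, p_lam' = b - lam, p_delta = 0, p_vs = vs, p_vs' = - vs,
     p_rho = - (vs * (lam - b)),
     p_a = lam^2 - b * lam, p_b = b, p_c = 0,
     p_d = - b, p_e = 1, p_f = 0,
     p_D = b * (lam - b), p_E = b, p_F = lam^2 - b * lam,
     p_d' = 0, p_e' = 1, p_f' = b,
     p_D' = 0, p_E' = 0, p_F' = lam^2 - b * lam\<rparr>"


section \<open>Well-definedness\<close>

declare add_bit_eq_xor [simp del] mult_bit_eq_and [simp del]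

lemma relations_wt:
  assumes "(f, g) \<in> relations P"
  shows "wt (gen_sig (p_sign P)) f" and "wt (gen_sig (p_sign P)) g"
    and "parallel (gen_sig (p_sign P)) f g"
  using assms by (auto simp: relations_def gen_sig_def parallel_def)

lemma trm_eq_wt:
  assumes "trm_eq S R f g"
  shows "wt S f \<and> wt S g \<and> parallel S f g"
  using assms
  by induction (auto simp: parallel_def add_ac)

lemma mem_cls_self: "wt S f \<Longrightarrow> f \<in> cls S R f"
  by (simp add: cls_def trm_eq.refl)

lemma cls_eqI: "trm_eq S R f g \<Longrightarrow> cls S R f = cls S R g"
  unfolding cls_def using trm_eq.sym trm_eq.trans by fast

lemma rep_cls: "wt S f \<Longrightarrow> trm_eq S R f (rep (cls S R f))"
  using someI[of "\<lambda>g. g \<in> cls S R f" f] by (simp add: rep_def cls_def trm_eq.refl)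

lemma mem_Hom_presented:
  "W \<in> Hom (presented S R) m n p \<longleftrightarrow>
     (\<exists>f. W = cls S R f \<and> wt S f \<and> tdom S f = m \<and> tcod S f = n \<and> tpar S f = p)"
proof -
  have "tdom S (rep (cls S R f)) = tdom S f \<and> tcod S (rep (cls S R f)) = tcod S f \<and>
      tpar S (rep (cls S R f)) = tpar S f" if "wt S f" for f
    using trm_eq_wt[OF rep_cls[OF that, of R]] by (simp add: parallel_def)
  then show ?thesis
    by (auto simp: Hom_def presented_def)
qed

lemma Hom_presentedE:
  assumes "W \<in> Hom (presented S R) m n p"
  obtains f where "W = cls S R f" "wt S f" "tdom S f = m" "tcod S f = n" "tpar S f = p"
  using assms mem_Hom_presented by metis

lemma cls_in_Hom:
  "wt S f \<Longrightarrow> tdom S f = m \<Longrightarrow> tcod S f = n \<Longrightarrow> tpar S f = p \<Longrightarrow>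
    cls S R f \<in> Hom (presented S R) m n p"
  using mem_Hom_presented by blast

lemma Cmp_cls:
  assumes "wt S (f \<cdot> g)"
  shows "Cmp (presented S R) (cls S R f) (cls S R g) = cls S R (f \<cdot> g)"
proof -
  have "trm_eq S R (f \<cdot> g) (rep (cls S R f) \<cdot> rep (cls S R g))"
    using assms by (intro trm_eq.cong_cmp rep_cls) auto
  from cls_eqI[OF this] show ?thesis by (simp add: presented_def)
qed

lemma Tns_cls:
  assumes "wt S (f \<boxtimes> g)"
  shows "Tns (presented S R) (cls S R f) (cls S R g) = cls S R (f \<boxtimes> g)"
proof -
  have "trm_eq S R (f \<boxtimes> g) (rep (cls S R f) \<boxtimes> rep (cls S R g))"
    using assms by (intro trm_eq.cong_tns rep_cls) auto
  from cls_eqI[OF this] show ?thesis by (simp add: presented_def)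
qed

lemma Add_cls:
  assumes "wt S (f \<boxplus> g)"
  shows "Add (presented S R) (cls S R f) (cls S R g) = cls S R (f \<boxplus> g)"
proof -
  have "trm_eq S R (f \<boxplus> g) (rep (cls S R f) \<boxplus> rep (cls S R g))"
    using assms by (intro trm_eq.cong_add rep_cls) auto
  from cls_eqI[OF this] show ?thesis by (simp add: presented_def)
qed

lemma Scl_cls:
  assumes "wt S f"
  shows "Scl (presented S R) k (cls S R f) = cls S R (k \<star> f)"
proof -
  have "trm_eq S R (k \<star> f) (k \<star> rep (cls S R f))"
    using assms by (intro trm_eq.cong_scl rep_cls) auto
  from cls_eqI[OF this] show ?thesis by (simp add: presented_def)
qed

lemma presented_simps:
  "Ide (presented S R) m = cls S R (TId m)"
  "Zer (presented S R) m n p = cls S R (TZero m n p)"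
  "UntO (presented S R) = 0"
  "TnsO (presented S R) m n = m + n"
  by (simp_all add: presented_def)

lemma Hom_space_simps:
  "carrier (Hom_space C x y p) = Hom C x y p"
  "f \<oplus>\<^bsub>Hom_space C x y p\<^esub> g = Add C f g"
  "\<zero>\<^bsub>Hom_space C x y p\<^esub> = Zer C x y p"
  by (simp_all add: Hom_space_def)

lemma presented_vector_space:
  fixes R :: "(('g, 'k::field) trm \<times> ('g, 'k) trm) set"
  shows "module (ring_of_type_algebra :: 'k ring) (Hom_space (presented S R) m n p)"
proof -
  let ?P = "presented S R"
  note calc = presented_simps Add_cls Scl_cls
  have sum_in: "Add ?P W Y \<in> Hom ?P m n p" if "W \<in> Hom ?P m n p" "Y \<in> Hom ?P m n p" for W Y
    using that by (elim Hom_presentedE) (simp add: calc parallel_def cls_in_Hom)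
  have scl_in: "Scl ?P k W \<in> Hom ?P m n p" if "W \<in> Hom ?P m n p" for W k
    using that by (elim Hom_presentedE) (simp add: calc parallel_def cls_in_Hom)
  have zero_in: "Zer ?P m n p \<in> Hom ?P m n p"
    by (simp add: calc cls_in_Hom)
  have assoc: "Add ?P (Add ?P W Y) Z = Add ?P W (Add ?P Y Z)"
    if "W \<in> Hom ?P m n p" "Y \<in> Hom ?P m n p" "Z \<in> Hom ?P m n p" for W Y Z
    using that
    by (elim Hom_presentedE) (simp add: calc parallel_def cls_eqI[OF trm_eq.add_assoc])
  have comm: "Add ?P W Y = Add ?P Y W"
    if "W \<in> Hom ?P m n p" "Y \<in> Hom ?P m n p" for W Y
  proof -
    from that obtain f g where "W = cls S R f" "Y = cls S R g"
      "wt S (f \<boxplus> g)" "wt S (g \<boxplus> f)"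
      by (elim Hom_presentedE) (simp add: parallel_def)
    then show ?thesis by (simp only: calc cls_eqI[OF trm_eq.add_commute])
  qed
  have zero: "Add ?P (Zer ?P m n p) W = W" if "W \<in> Hom ?P m n p" for W
    using that
  proof (elim Hom_presentedE)
    fix f assume f: "W = cls S R f" "wt S f" "tdom S f = m" "tcod S f = n" "tpar S f = p"
    then show ?thesis
      using cls_eqI[OF trm_eq.add_zero[of S f R]] by (simp add: calc parallel_def)
  qed
  have minus: "\<exists>Y \<in> Hom ?P m n p. Add ?P Y W = Zer ?P m n p" if "W \<in> Hom ?P m n p" for W
  proof (rule bexI[of _ "Scl ?P (- 1) W"])
    show "Add ?P (Scl ?P (- 1) W) W = Zer ?P m n p" using that
    proof (elim Hom_presentedE)
      fix f assume f: "W = cls S R f" "wt S f" "tdom S f = m" "tcod S f = n" "tpar S f = p"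
      then show ?thesis
        using cls_eqI[OF trm_eq.add_minus[of S f R]] by (simp add: calc parallel_def)
    qed
  qed (use that scl_in in blast)
  have scl1: "Scl ?P 1 W = W" if "W \<in> Hom ?P m n p" for W
    using that by (elim Hom_presentedE) (simp add: calc cls_eqI[OF trm_eq.scl_one])
  have scl2: "Scl ?P (k * l) W = Scl ?P k (Scl ?P l W)" if "W \<in> Hom ?P m n p" for W k l
    using that by (elim Hom_presentedE) (simp add: calc cls_eqI[OF trm_eq.scl_scl])
  have scl3: "Scl ?P (k + l) W = Add ?P (Scl ?P k W) (Scl ?P l W)"
    if "W \<in> Hom ?P m n p" for W k l
    using that
    by (elim Hom_presentedE) (simp add: calc parallel_def cls_eqI[OF trm_eq.add_scl])
  have scl4: "Scl ?P k (Add ?P W Y) = Add ?P (Scl ?P k W) (Scl ?P k Y)"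
    if "W \<in> Hom ?P m n p" "Y \<in> Hom ?P m n p" for W Y k
    using that
    by (elim Hom_presentedE) (simp add: calc parallel_def cls_eqI[OF trm_eq.scl_add])
  show ?thesis
  proof (rule moduleI)
    show "cring (ring_of_type_algebra :: 'k ring)"
      by (rule cring_from_type_algebra)
    show "abelian_group (Hom_space ?P m n p)"
      by (rule abelian_groupI; unfold Hom_space_simps)
        (rule sum_in zero_in assoc comm zero minus; assumption)+
  qed (auto simp: Hom_space_def ring_of_type_algebra_def scl_in scl1 scl2 scl3 scl4)
qed

theorem presented_supercategory:
  "strict_monoidal_supercategory (presented S R)"
proof -
  note calc = presented_simps Add_cls Scl_cls Cmp_cls Tns_cls parallel_def
  have units: "trm_eq S R (f \<cdot> TId m) f" "trm_eq S R (TId n \<cdot> f) f"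
    if "wt S f" "tdom S f = m" "tcod S f = n" for f m n
    using that trm_eq.cmp_id[of S f R] trm_eq.id_cmp[of S f R] by auto
  show ?thesis
    apply (rule strict_monoidal_supercategory.intro)
    subgoal by (rule presented_vector_space)
    subgoal by (simp add: calc cls_in_Hom)
    subgoal by (elim Hom_presentedE) (simp add: calc cls_in_Hom)
    subgoal by (elim Hom_presentedE) (simp add: calc cls_eqI[OF units(1)])
    subgoal by (elim Hom_presentedE) (simp add: calc cls_eqI[OF units(2)])
    subgoal by (elim Hom_presentedE) (simp add: calc cls_eqI[OF trm_eq.cmp_assoc])
    subgoal by (elim Hom_presentedE) (simp add: calc cls_eqI[OF trm_eq.cmp_add_left])
    subgoal by (elim Hom_presentedE) (simp add: calc cls_eqI[OF trm_eq.cmp_add_right])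
    subgoal by (elim Hom_presentedE) (simp add: calc cls_eqI[OF trm_eq.cmp_scl_left])
    subgoal by (elim Hom_presentedE) (simp add: calc cls_eqI[OF trm_eq.cmp_scl_right])
    subgoal by (simp add: presented_simps)
    subgoal by (simp add: presented_simps)
    subgoal by (simp add: presented_simps)
    subgoal by (elim Hom_presentedE) (simp add: calc cls_in_Hom)
    subgoal by (simp add: calc cls_eqI[OF trm_eq.tns_id])
    subgoal by (elim Hom_presentedE) (simp add: calc cls_eqI[OF trm_eq.tns_assoc])
    subgoal by (elim Hom_presentedE) (simp add: calc cls_eqI[OF trm_eq.tns_unit_left])
    subgoal by (elim Hom_presentedE) (simp add: calc cls_eqI[OF trm_eq.tns_unit_right])
    subgoal by (elim Hom_presentedE) (simp add: calc cls_eqI[OF trm_eq.tns_add_left])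
    subgoal by (elim Hom_presentedE) (simp add: calc cls_eqI[OF trm_eq.tns_add_right])
    subgoal by (elim Hom_presentedE) (simp add: calc cls_eqI[OF trm_eq.tns_scl_left])
    subgoal by (elim Hom_presentedE) (simp add: calc cls_eqI[OF trm_eq.tns_scl_right])
    subgoal by (elim Hom_presentedE) (simp add: calc cls_eqI[OF trm_eq.interchange])
    done
qed

lemma ksign_0 [simp]: "ksign 0 = 1"
  by (simp add: ksign_def)

lemma Hom_monoidal_op [simp]: "Hom (monoidal_op C) x y p = Hom C x y p"
  by (simp add: Hom_def monoidal_op_def)

lemma monoidal_op_simps [simp]:
  "Ide (monoidal_op C) = Ide C" "Cmp (monoidal_op C) = Cmp C" "Add (monoidal_op C) = Add C"
  "Scl (monoidal_op C) = Scl C" "Zer (monoidal_op C) = Zer C" "UntO (monoidal_op C) = UntO C"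
  "TnsO (monoidal_op C) x y = TnsO C y x"
  by (simp_all add: monoidal_op_def)

lemma Tns_monoidal_op:
  "f \<in> Hom C x y p \<Longrightarrow> g \<in> Hom C x' y' q \<Longrightarrow>
    Tns (monoidal_op C) f g = Scl C (ksign (p * q)) (Tns C g f)"
  by (auto simp: monoidal_op_def Hom_def)

context strict_monoidal_supercategory
begin

lemma Scl_in: "f \<in> Hom C x y p \<Longrightarrow> Scl C k f \<in> Hom C x y p"
  using module.smult_closed[OF vector_space, of k f x y p]
  by (simp add: Hom_space_def ring_of_type_algebra_def)

lemma Add_in: "f \<in> Hom C x y p \<Longrightarrow> g \<in> Hom C x y p \<Longrightarrow> Add C f g \<in> Hom C x y p"
proof -
  interpret V: module "ring_of_type_algebra :: 'k ring" "Hom_space C x y p"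
    by (rule vector_space)
  show "f \<in> Hom C x y p \<Longrightarrow> g \<in> Hom C x y p \<Longrightarrow> ?thesis"
    using V.add.m_closed[of f g] by (simp add: Hom_space_def)
qed

lemma Scl_Add: "f \<in> Hom C x y p \<Longrightarrow> g \<in> Hom C x y p \<Longrightarrow>
    Scl C k (Add C f g) = Add C (Scl C k f) (Scl C k g)"
  using module.smult_r_distr[OF vector_space, of k f x y p g]
  by (simp add: Hom_space_def ring_of_type_algebra_def)

lemma Scl_Scl: "f \<in> Hom C x y p \<Longrightarrow> Scl C k (Scl C l f) = Scl C (k * l) f"
  using module.smult_assoc1[OF vector_space, of k l f x y p]
  by (simp add: Hom_space_def ring_of_type_algebra_def)

lemma Scl_1: "f \<in> Hom C x y p \<Longrightarrow> Scl C 1 f = f"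
  using module.smult_one[OF vector_space, of f x y p]
  by (simp add: Hom_space_def ring_of_type_algebra_def)

theorem monoidal_op_supercategory: "strict_monoidal_supercategory (monoidal_op C)"
proof (rule strict_monoidal_supercategory.intro, unfold Hom_monoidal_op monoidal_op_simps,
    goal_cases)
  case 1
  then show ?case using vector_space by (simp add: Hom_space_def)
next
  case (14 f x y p g x' y' q)
  then show ?case
    using Tns_in[of g x' y' q f x y p]
    by (simp add: Tns_monoidal_op[of f C x y p g x' y' q] Scl_in add.commute)
next
  case (15 x y)
  then show ?case
    by (simp add: Tns_monoidal_op[OF Ide_in Ide_in] Tns_Ide Scl_1[OF Ide_in])
next
  case (16 f x y p g x' y' q h x'' y'' r)
  note T = Tns_in[OF 16(2,1)] Tns_in[OF 16(3,2)]
  have "Tns (monoidal_op C) (Tns (monoidal_op C) f g) h =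
      Scl C (ksign ((q + p) * r) * ksign (p * q)) (Tns C h (Tns C g f))"
    by (simp add: Tns_monoidal_op[OF 16(1,2)] Tns_monoidal_op[OF Scl_in[OF T(1)] 16(3)]
        Tns_Scl_right[OF 16(3) T(1)] Scl_Scl[OF Tns_in[OF 16(3) T(1)]])
  also have "\<dots> = Scl C (ksign (p * (r + q)) * ksign (q * r)) (Tns C (Tns C h g) f)"
    by (cases p; cases q; cases r) (simp_all add: ksign_def Tns_assoc[OF 16(3,2,1)])
  also have "\<dots> = Tns (monoidal_op C) f (Tns (monoidal_op C) g h)"
    by (simp add: Tns_monoidal_op[OF 16(2,3)] Tns_monoidal_op[OF 16(1) Scl_in[OF T(2)]]
        Tns_Scl_left[OF T(2) 16(1)] Scl_Scl[OF Tns_in[OF T(2) 16(1)]])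
  finally show ?case .
next
  case (17 f x y p)
  then show ?case by (simp add: Tns_monoidal_op[OF Ide_in] Tns_unit_right Scl_1)
next
  case (18 f x y p)
  then show ?case by (simp add: Tns_monoidal_op[OF _ Ide_in] Tns_unit_left Scl_1)
next
  case (19 f x y p f' g x' y' q)
  then show ?case
    by (simp add: Tns_monoidal_op[OF 19(1,3)] Tns_monoidal_op[OF 19(2,3)]
        Tns_monoidal_op[OF Add_in[OF 19(1,2)] 19(3)] Tns_Add_right[OF 19(3,1,2)]
        Scl_Add[OF Tns_in[OF 19(3,1)] Tns_in[OF 19(3,2)]])
next
  case (20 f x y p g x' y' q g')
  then show ?case
    by (simp add: Tns_monoidal_op[OF 20(1,2)] Tns_monoidal_op[OF 20(1,3)]
        Tns_monoidal_op[OF 20(1) Add_in[OF 20(2,3)]] Tns_Add_left[OF 20(2,3,1)]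
        Scl_Add[OF Tns_in[OF 20(2,1)] Tns_in[OF 20(3,1)]])
next
  case (21 f x y p g x' y' q k)
  then show ?case
    by (simp add: Tns_monoidal_op[OF 21] Tns_monoidal_op[OF Scl_in[OF 21(1)] 21(2)]
        Tns_Scl_right[OF 21(2,1)] Scl_Scl[OF Tns_in[OF 21(2,1)]] mult.commute)
next
  case (22 f x y p g x' y' q k)
  then show ?case
    by (simp add: Tns_monoidal_op[OF 22] Tns_monoidal_op[OF 22(1) Scl_in[OF 22(2)]]
        Tns_Scl_left[OF 22(2,1)] Scl_Scl[OF Tns_in[OF 22(2,1)]] mult.commute)
next
  case (23 f y z p g y' z' q h x r h' x' s)
  note T = Tns_in[OF 23(2,1)] Tns_in[OF 23(4,3)]
  note C = Cmp_in[OF 23(1,3)] Cmp_in[OF 23(2,4)]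
  have "Cmp C (Tns (monoidal_op C) f g) (Tns (monoidal_op C) h h') =
      Scl C (ksign (p * q) * (ksign (r * s) * ksign (p * s)))
        (Tns C (Cmp C g h') (Cmp C f h))"
    by (simp add: Tns_monoidal_op[OF 23(1,2)] Tns_monoidal_op[OF 23(3,4)]
        Cmp_Scl_left[OF T(1) Scl_in[OF T(2)]] Cmp_Scl_right[OF T] Scl_in[OF Cmp_in[OF T]]
        super_interchange[OF 23(2,1,4,3)] Scl_Scl[OF Tns_in[OF C(2,1)]]
        Scl_in[OF Tns_in[OF C(2,1)]])
  also have "ksign (p * q) * (ksign (r * s) * ksign (p * s)) =
      (ksign (q * r) * ksign ((p + r) * (q + s)) :: 'k)"
    by (cases p; cases q; cases r; cases s) (simp_all add: ksign_def)
  also have "Scl C (ksign (q * r) * ksign ((p + r) * (q + s))) (Tns C (Cmp C g h') (Cmp C f h)) =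
      Scl C (ksign (q * r)) (Tns (monoidal_op C) (Cmp C f h) (Cmp C g h'))"
    by (simp add: Tns_monoidal_op[OF C] Scl_Scl[OF Tns_in[OF C(2,1)]])
  finally show ?case by simp
qed ((rule Ide_in Cmp_in Cmp_Ide Ide_Cmp Cmp_assoc Cmp_Add_left Cmp_Add_right Cmp_Scl_left
    Cmp_Scl_right TnsO_assoc[symmetric] TnsO_unit_left TnsO_unit_right; assumption)+)

end

end

(* Reflecting diagrams left to right sends H to H, U to U and A to sigma A, where
   sigma = 1 for even and sigma = -1 for odd A. The sign matches the two values varsigma and
   varsigma', which reflection interchanges and which differ exactly by sigma. Since e = e' = 1,
   the relation for (H \<otimes> I)(I \<otimes> U) can be solved for (I \<otimes> H)(U \<otimes> I), and this is its reflection.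
   The reflected relation with coefficients D, E, F follows by composing that one with I \<otimes> H and
   reducing (I \<otimes> H)^2 by the quadratic relation; likewise for A. Doing this twice fixes the
   generators, because sigma^2 = 1 and the Koszul signs cancel, so the reflections are inverse
   isomorphisms. *)

theory Submission
  imports Defs
begin

section \<open>Arithmetic of arrows in a strict monoidal supercategory\<close>

context strict_monoidal_supercategory
begin

lemma Add_assoc:
  assumes "f \<in> Hom C x y p" "g \<in> Hom C x y p" "h \<in> Hom C x y p"
  shows "Add C (Add C f g) h = Add C f (Add C g h)"
proof -
  interpret V: module "ring_of_type_algebra :: 'k ring" "Hom_space C x y p"
    by (rule vector_space)
  show ?thesis using V.a_assoc[of f g h] assms by (simp add: Hom_space_simps)
qed

lemma Add_commute:
  assumes "f \<in> Hom C x y p" "g \<in> Hom C x y p"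
  shows "Add C f g = Add C g f"
proof -
  interpret V: module "ring_of_type_algebra :: 'k ring" "Hom_space C x y p"
    by (rule vector_space)
  show ?thesis using V.a_comm[of f g] assms by (simp add: Hom_space_simps)
qed

lemma Zer_in: "Zer C x y p \<in> Hom C x y p"
proof -
  interpret V: module "ring_of_type_algebra :: 'k ring" "Hom_space C x y p"
    by (rule vector_space)
  show ?thesis using V.zero_closed by (simp add: Hom_space_simps)
qed

lemma Add_Zer:
  assumes "f \<in> Hom C x y p"
  shows "Add C (Zer C x y p) f = f" "Add C f (Zer C x y p) = f"
proof -
  interpret V: module "ring_of_type_algebra :: 'k ring" "Hom_space C x y p"
    by (rule vector_space)
  show "Add C (Zer C x y p) f = f" "Add C f (Zer C x y p) = f"
    using V.l_zero[of f] V.r_zero[of f] assms by (simp_all add: Hom_space_simps)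
qed

lemma Scl_plus:
  assumes "f \<in> Hom C x y p"
  shows "Scl C (k + l) f = Add C (Scl C k f) (Scl C l f)"
  using module.smult_l_distr[OF vector_space, of k l f x y p] assms
  by (simp add: Hom_space_def ring_of_type_algebra_def)

lemma Scl_0:
  assumes "f \<in> Hom C x y p"
  shows "Scl C 0 f = Zer C x y p"
  using module.smult_l_null[OF vector_space, of f x y p] assms
  by (simp add: Hom_space_def ring_of_type_algebra_def)

lemma Hom_arr:
  "f \<in> Arr C \<Longrightarrow> f \<in> Hom C (Src C f) (Tgt C f) (Par C f)"
  by (simp add: Hom_def)

lemma arr_Ide [simp]:
  "Ide C x \<in> Arr C" "Src C (Ide C x) = x" "Tgt C (Ide C x) = x" "Par C (Ide C x) = 0"
  using Ide_in[of x] by (simp_all add: Hom_def)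

lemma arr_Zer [simp]:
  "Zer C x y p \<in> Arr C" "Src C (Zer C x y p) = x" "Tgt C (Zer C x y p) = y"
  "Par C (Zer C x y p) = p"
  using Zer_in[of x y p] by (simp_all add: Hom_def)

lemma arr_Scl [simp]:
  assumes "f \<in> Arr C"
  shows "Scl C k f \<in> Arr C" "Src C (Scl C k f) = Src C f" "Tgt C (Scl C k f) = Tgt C f"
    "Par C (Scl C k f) = Par C f"
  using Scl_in[OF Hom_arr[OF assms], of k] by (simp_all add: Hom_def)

lemma arr_Cmp [simp]:
  assumes "f \<in> Arr C" "g \<in> Arr C" "Src C f = Tgt C g"
  shows "Cmp C f g \<in> Arr C" "Src C (Cmp C f g) = Src C g" "Tgt C (Cmp C f g) = Tgt C f"
    "Par C (Cmp C f g) = Par C f + Par C g"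
  using Cmp_in[of f "Src C f" "Tgt C f" "Par C f" g "Src C g" "Par C g"] assms
  by (simp_all add: Hom_def)

lemma arr_Tns [simp]:
  assumes "f \<in> Arr C" "g \<in> Arr C"
  shows "Tns C f g \<in> Arr C" "Src C (Tns C f g) = TnsO C (Src C f) (Src C g)"
    "Tgt C (Tns C f g) = TnsO C (Tgt C f) (Tgt C g)"
    "Par C (Tns C f g) = Par C f + Par C g"
  using Tns_in[OF assms[THEN Hom_arr]] by (simp_all add: Hom_def)

text \<open>The counterpart of \<open>parallel\<close> for arrows; it includes membership in
  \<open>Arr C\<close>, so that it alone guarantees that a sum is an arrow.\<close>

definition par :: "'m \<Rightarrow> 'm \<Rightarrow> bool" where
  "par f g \<longleftrightarrow> f \<in> Arr C \<and> g \<in> Arr C \<and> Src C f = Src C g \<and> Tgt C f = Tgt C g \<and>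
     Par C f = Par C g"

lemma parD:
  assumes "par f g"
  shows "f \<in> Hom C (Src C f) (Tgt C f) (Par C f)" "g \<in> Hom C (Src C f) (Tgt C f) (Par C f)"
  using assms by (auto simp: par_def Hom_def)

lemma arr_Add [simp]:
  assumes "par f g"
  shows "Add C f g \<in> Arr C" "Src C (Add C f g) = Src C f" "Tgt C (Add C f g) = Tgt C f"
    "Par C (Add C f g) = Par C f"
  using Add_in[OF parD[OF assms]] by (simp_all add: Hom_def)

text \<open>
  Phrased with \<open>Src\<close>, \<open>Tgt\<close> and \<open>Par\<close> instead of \<open>Hom\<close>, the axioms are conditional rewrite rules
  whose premises the simplifier can discharge: no variable occurs in the premises only.
\<close>

lemma
  shows arr_Cmp_Ide:
      "f \<in> Arr C \<Longrightarrow> Src C f = x \<Longrightarrow> Cmp C f (Ide C x) = f"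
      "f \<in> Arr C \<Longrightarrow> Tgt C f = x \<Longrightarrow> Cmp C (Ide C x) f = f"
    and arr_Cmp_assoc:
      "f \<in> Arr C \<Longrightarrow> g \<in> Arr C \<Longrightarrow> h \<in> Arr C \<Longrightarrow> Src C f = Tgt C g \<Longrightarrow> Src C g = Tgt C h \<Longrightarrow>
        Cmp C (Cmp C f g) h = Cmp C f (Cmp C g h)"
    and arr_Cmp_linear:
      "par f f' \<Longrightarrow> g \<in> Arr C \<Longrightarrow> Src C f = Tgt C g \<Longrightarrow>
        Cmp C (Add C f f') g = Add C (Cmp C f g) (Cmp C f' g)"
      "par g g' \<Longrightarrow> f \<in> Arr C \<Longrightarrow> Src C f = Tgt C g \<Longrightarrow>
        Cmp C f (Add C g g') = Add C (Cmp C f g) (Cmp C f g')"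
      "f \<in> Arr C \<Longrightarrow> g \<in> Arr C \<Longrightarrow> Src C f = Tgt C g \<Longrightarrow> Cmp C (Scl C k f) g = Scl C k (Cmp C f g)"
      "f \<in> Arr C \<Longrightarrow> g \<in> Arr C \<Longrightarrow> Src C f = Tgt C g \<Longrightarrow> Cmp C f (Scl C k g) = Scl C k (Cmp C f g)"
    and arr_Tns_assoc:
      "f \<in> Arr C \<Longrightarrow> g \<in> Arr C \<Longrightarrow> h \<in> Arr C \<Longrightarrow> Tns C (Tns C f g) h = Tns C f (Tns C g h)"
    and arr_Tns_unit:
      "f \<in> Arr C \<Longrightarrow> Tns C (Ide C (UntO C)) f = f"
      "f \<in> Arr C \<Longrightarrow> Tns C f (Ide C (UntO C)) = f"
    and arr_Tns_linear:
      "par f f' \<Longrightarrow> g \<in> Arr C \<Longrightarrow> Tns C (Add C f f') g = Add C (Tns C f g) (Tns C f' g)"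
      "par g g' \<Longrightarrow> f \<in> Arr C \<Longrightarrow> Tns C f (Add C g g') = Add C (Tns C f g) (Tns C f g')"
      "f \<in> Arr C \<Longrightarrow> g \<in> Arr C \<Longrightarrow> Tns C (Scl C k f) g = Scl C k (Tns C f g)"
      "f \<in> Arr C \<Longrightarrow> g \<in> Arr C \<Longrightarrow> Tns C f (Scl C k g) = Scl C k (Tns C f g)"
    and arr_interchange:
      "f \<in> Arr C \<Longrightarrow> g \<in> Arr C \<Longrightarrow> h \<in> Arr C \<Longrightarrow> h' \<in> Arr C \<Longrightarrow> Src C f = Tgt C h \<Longrightarrow>
        Src C g = Tgt C h' \<Longrightarrow> Cmp C (Tns C f g) (Tns C h h') =
        Scl C (ksign (Par C g * Par C h)) (Tns C (Cmp C f h) (Cmp C g h'))"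
    and arr_Add_commute:
      "par f g \<Longrightarrow> Add C f g = Add C g f"
    and arr_Add_assoc:
      "par f g \<Longrightarrow> par g h \<Longrightarrow> Add C (Add C f g) h = Add C f (Add C g h)"
    and arr_Zer_Add:
      "f \<in> Arr C \<Longrightarrow> Src C f = x \<Longrightarrow> Tgt C f = y \<Longrightarrow> Par C f = p \<Longrightarrow> Add C (Zer C x y p) f = f"
    and arr_Scl_plus:
      "f \<in> Arr C \<Longrightarrow> Scl C (k + l) f = Add C (Scl C k f) (Scl C l f)"
    and arr_Scl_mult:
      "f \<in> Arr C \<Longrightarrow> Scl C (k * l) f = Scl C k (Scl C l f)"
    and arr_Scl_1:
      "f \<in> Arr C \<Longrightarrow> Scl C 1 f = f"
    and arr_Scl_0:
      "f \<in> Arr C \<Longrightarrow> Scl C 0 f = Zer C (Src C f) (Tgt C f) (Par C f)"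
    and arr_Scl_Add:
      "par f g \<Longrightarrow> Scl C k (Add C f g) = Add C (Scl C k f) (Scl C k g)"
    and arr_Add_Zer:
      "f \<in> Arr C \<Longrightarrow> Src C f = x \<Longrightarrow> Tgt C f = y \<Longrightarrow> Par C f = p \<Longrightarrow> Add C f (Zer C x y p) = f"
  by (rule Cmp_Ide Ide_Cmp Cmp_assoc Cmp_Add_left Cmp_Add_right Cmp_Scl_left Cmp_Scl_right
      Tns_assoc Tns_unit_left Tns_unit_right Tns_Add_left Tns_Add_right Tns_Scl_left Tns_Scl_right
      super_interchange Add_commute Add_assoc Add_Zer Scl_plus Scl_Scl[symmetric] Scl_1 Scl_0 Scl_Add;
      force simp: Hom_def par_def)+

lemmas arr_linear = arr_Cmp_linear arr_Tns_linear arr_Scl_Add arr_Scl_1 arr_Scl_0 arr_Scl_mult[symmetric]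
  arr_Zer_Add arr_Add_Zer

text \<open>The Koszul sign is trivial because the identity passed by \<open>f\<close> is
  even.\<close>

lemma Tns_Ide_Cmp:
  "f \<in> Arr C \<Longrightarrow> g \<in> Arr C \<Longrightarrow> Src C f = Tgt C g \<Longrightarrow>
    Cmp C (Tns C (Ide C x) f) (Tns C (Ide C x) g) = Tns C (Ide C x) (Cmp C f g)"
  by (simp add: arr_interchange arr_Cmp_Ide arr_Scl_1)

text \<open>Coordinates with respect to three parallel arrows, which need not be linearly
  independent: equality of coefficients implies equality of arrows, and only this direction is
  used.\<close>

definition lc :: "'m \<Rightarrow> 'm \<Rightarrow> 'm \<Rightarrow> 'k \<Rightarrow> 'k \<Rightarrow> 'k \<Rightarrow> 'm" where
  "lc u v w k l m = Add C (Add C (Scl C k u) (Scl C l v)) (Scl C m w)"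

lemma lc_Add:
  assumes "par u v" "par u w"
  shows "Add C (lc u v w k l m) (lc u v w k' l' m') = lc u v w (k + k') (l + l') (m + m')"
proof -
  interpret V: module "ring_of_type_algebra :: 'k ring" "Hom_space C (Src C u) (Tgt C u) (Par C u)"
    by (rule vector_space)
  have i: "u \<in> Hom C (Src C u) (Tgt C u) (Par C u)" "v \<in> Hom C (Src C u) (Tgt C u) (Par C u)"
    "w \<in> Hom C (Src C u) (Tgt C u) (Par C u)"
    using assms by (auto simp: par_def Hom_def)
  note ac = V.add.m_ac[unfolded Hom_space_simps]
  show ?thesis
    unfolding lc_def using i
    by (simp add: Scl_plus[OF i(1)] Scl_plus[OF i(2)] Scl_plus[OF i(3)] ac Scl_in Add_in)
qed

lemma lc_Scl:
  assumes "par u v" "par u w"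
  shows "Scl C q (lc u v w k l m) = lc u v w (q * k) (q * l) (q * m)"
  using assms by (simp add: lc_def arr_linear par_def)

lemma lc_units:
  assumes "par u v" "par u w"
  shows "lc u v w 1 0 0 = u" "lc u v w 0 1 0 = v" "lc u v w 0 0 1 = w"
  using assms by (simp_all add: lc_def par_def arr_linear)

lemma lc_Cmp:
  assumes "par u v" "par u w" "f \<in> Arr C"
  shows "Src C f = Tgt C u \<Longrightarrow> Cmp C f (lc u v w k l m) = lc (Cmp C f u) (Cmp C f v) (Cmp C f w) k l m"
    and "Tgt C f = Src C u \<Longrightarrow> Cmp C (lc u v w k l m) f = lc (Cmp C u f) (Cmp C v f) (Cmp C w f) k l m"
  using assms by (simp_all add: lc_def arr_linear par_def)

lemma lc_Tns:
  assumes "par u v" "par u w" "f \<in> Arr C"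
  shows "Tns C f (lc u v w k l m) = lc (Tns C f u) (Tns C f v) (Tns C f w) k l m"
  using assms by (simp_all add: lc_def arr_linear par_def)

end

section \<open>Evaluation of terms and the universal property of a presentation\<close>

primrec teval :: "('o, 'm, 'k::field) supercat \<Rightarrow> (nat \<Rightarrow> 'o) \<Rightarrow> ('g \<Rightarrow> 'm) \<Rightarrow>
    ('g, 'k) trm \<Rightarrow> 'm" where
  "teval C ob \<phi> (TGen x) = \<phi> x"
| "teval C ob \<phi> (TId m) = Ide C (ob m)"
| "teval C ob \<phi> (TZero m n p) = Zer C (ob m) (ob n) p"
| "teval C ob \<phi> (f \<cdot> g) = Cmp C (teval C ob \<phi> f) (teval C ob \<phi> g)"
| "teval C ob \<phi> (f \<boxtimes> g) = Tns C (teval C ob \<phi> f) (teval C ob \<phi> g)"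
| "teval C ob \<phi> (f \<boxplus> g) = Add C (teval C ob \<phi> f) (teval C ob \<phi> g)"
| "teval C ob \<phi> (k \<star> f) = Scl C k (teval C ob \<phi> f)"

text \<open>The data of a strict monoidal functor out of the free supercategory on the generators,
  before any relation is imposed.\<close>

locale valuation = strict_monoidal_supercategory C
  for C :: "('o, 'm, 'k::field) supercat" +
  fixes S :: "'g signature" and ob :: "nat \<Rightarrow> 'o" and \<phi> :: "'g \<Rightarrow> 'm"
  assumes ob_0: "ob 0 = UntO C"
    and ob_add: "ob (m + n) = TnsO C (ob m) (ob n)"
    and gen_in: "\<phi> x \<in> Hom C (ob (gdom S x)) (ob (gcod S x)) (gpar S x)"
begin

abbreviation ev :: "('g, 'k) trm \<Rightarrow> 'm" where "ev \<equiv> teval C ob \<phi>"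

lemma ev_arr [simp]:
  assumes "wt S f"
  shows "ev f \<in> Arr C" "Src C (ev f) = ob (tdom S f)" "Tgt C (ev f) = ob (tcod S f)"
    "Par C (ev f) = tpar S f"
proof -
  \<comment> \<open>The four claims go through the induction together: a composite or a sum is an
    arrow only if its parts have matching sources, targets or parities.\<close>
  have "ev f \<in> Arr C \<and> Src C (ev f) = ob (tdom S f) \<and> Tgt C (ev f) = ob (tcod S f) \<and>
      Par C (ev f) = tpar S f"
    using assms
  proof (induction f)
    case (TGen x)
    then show ?case using gen_in[of x] by (simp add: Hom_def)
  qed (auto simp: ob_add parallel_def par_def)
  then show "ev f \<in> Arr C" "Src C (ev f) = ob (tdom S f)" "Tgt C (ev f) = ob (tcod S f)"
    "Par C (ev f) = tpar S f" by auto
qed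

lemma ev_in: "wt S f \<Longrightarrow> ev f \<in> Hom C (ob (tdom S f)) (ob (tcod S f)) (tpar S f)"
  by (simp add: Hom_def)

text \<open>Every rule of \<open>trm_eq\<close> other than \<open>rel\<close> reflects a law valid
  in each strict monoidal supercategory, so only the given relations have to be checked.\<close>

lemma ev_sound:
  assumes R: "\<And>f g. (f, g) \<in> R \<Longrightarrow> ev f = ev g"
    and "trm_eq S R f g"
  shows "ev f = ev g"
  using assms(2)
proof induction
  case (add_minus f)
  \<comment> \<open>The inverse of \<open>f\<close> is encoded as the multiple by -1, so the sum is
    the zero multiple of \<open>ev f\<close>.\<close>
  have "ev ((- 1) \<star> f \<boxplus> f) = Scl C (- 1 + 1) (ev f)"
    using add_minus arr_Scl_plus[of "ev f" "- 1" 1] by (simp add: arr_Scl_1)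
  then show ?case using add_minus by (simp add: arr_Scl_0)
next
  case (rel f g)
  then show ?case by (simp add: R)
next
  case (add_commute f g)
  then show ?case by (simp add: arr_Add_commute par_def parallel_def)
qed (auto simp: arr_Cmp_Ide arr_Cmp_assoc arr_Tns_assoc arr_Tns_unit arr_interchange arr_Add_assoc
    arr_Scl_plus arr_linear par_def parallel_def Tns_Ide ob_add ob_0 R)

text \<open>By \<open>ev_sound\<close> the value on a class does not depend on the representative
  chosen by \<open>rep\<close>; functoriality is then built into the recursion of
  \<open>teval\<close>.\<close>

lemma superfunctor:
  assumes "\<And>f g. (f, g) \<in> R \<Longrightarrow> ev f = ev g"
  shows "strict_monoidal_superfunctor (presented S R) C ob (\<lambda>W. ev (rep W))"
    and "wt S f \<Longrightarrow> ev (rep (cls S R f)) = ev f"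
proof -
  have ev_cls: "ev (rep (cls S R f)) = ev f" if "wt S f" for f
    using ev_sound[OF assms rep_cls[OF that]] by simp
  then show "wt S f \<Longrightarrow> ev (rep (cls S R f)) = ev f" .
  interpret P: strict_monoidal_supercategory "presented S R"
    by (rule presented_supercategory)
  note calc = presented_simps Add_cls Scl_cls Cmp_cls Tns_cls parallel_def ev_cls
  show "strict_monoidal_superfunctor (presented S R) C ob (\<lambda>W. ev (rep W))"
    by unfold_locales (auto elim!: Hom_presentedE simp: calc ob_0 ob_add ev_in)
qed

end


section \<open>Reflection of the defining relations\<close>

text \<open>
  The side conditions express that \<open>H \<mapsto> H\<close>, \<open>A \<mapsto> \<sigma> A\<close>, \<open>U \<mapsto> U\<close> satisfies the relations of \<open>P\<close>
  in the monoidal opposite of every model of \<open>P'\<close>. They come from comparing coefficients with respect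
  to \<open>U \<otimes> I, (I \<otimes> H)(U \<otimes> I), I \<otimes> U\<close> and to \<open>A \<otimes> I, (A \<otimes> I)(I \<otimes> H), I \<otimes> A\<close>.
\<close>

definition mirrored :: "'k::field \<Rightarrow> 'k params \<Rightarrow> 'k params \<Rightarrow> bool" where
  "mirrored \<sigma> P P' \<longleftrightarrow>
     p_sign P = p_sign P' \<and> p_lam P = p_lam P' \<and> p_lam' P = p_lam' P' \<and>
     p_delta P = \<sigma> * p_delta P' \<and> p_vs P = \<sigma> * p_vs' P' \<and> p_vs' P = \<sigma> * p_vs P' \<and>
     p_rho P = \<sigma> * ((p_d P' + p_lam' P') * p_vs' P' + p_f P' * p_delta P') \<and>
     p_a P = p_a P' \<and> p_b P = p_b P' \<and> p_c P' = \<sigma> * p_c P \<and>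
     p_e P = 1 \<and> p_e P' = 1 \<and> p_d P = - p_f P' \<and> p_f P = - p_d P' \<and>
     p_e' P = 1 \<and> p_e' P' = 1 \<and> p_d' P = - p_f' P' \<and> p_f' P = - p_d' P' \<and>
     p_E P = p_d P' + p_b P' \<and> p_F P = p_a P' - p_E P * p_d P' \<and>
     p_D P = p_c P' * p_vs' P' + p_f P' * p_lam P' - p_E P * p_f P' \<and>
     p_E' P = p_d' P' + p_b P' \<and> p_F' P = p_a P' - p_E' P * p_d' P' \<and>
     p_D' P = p_c P' * p_vs P' + p_f' P' * p_lam' P' - p_E' P * p_f' P'"

definition scale_A :: "('o, 'm, 'k::field) supercat \<Rightarrow> 'k \<Rightarrow> (gen \<Rightarrow> 'm) \<Rightarrow> gen \<Rightarrow> 'm" where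
  "scale_A C \<sigma> \<phi> = \<phi>(gA := Scl C \<sigma> (\<phi> gA))"

text \<open>Reversing the factors is harmless on the objects \<open>ob n\<close> since addition of
  natural numbers commutes, and rescaling \<open>A\<close> changes neither its type nor its
  parity.\<close>

lemma valuation_mirror:
  assumes "valuation C (gen_sig s) ob \<phi>"
  shows "valuation (monoidal_op C) (gen_sig s) ob (scale_A C \<sigma> \<phi>)"
proof -
  interpret valuation C "gen_sig s" ob \<phi> by (rule assms)
  interpret op: strict_monoidal_supercategory "monoidal_op C"
    by (rule monoidal_op_supercategory)
  show ?thesis
    by unfold_locales
      (use gen_in in \<open>auto simp: ob_0 ob_add[symmetric] add.commute scale_A_def Scl_in\<close>)
qed

text \<open>Each relation of \<open>P\<close>, read with its tensor factors reversed, becomes an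
  equation in the given model of \<open>P'\<close>. Both sides are expanded in
  \<open>?u, ?v, ?w\<close> or \<open>?x, ?y, ?z\<close>, and the coefficients agree by
  \<open>mirrored\<close>.\<close>

lemma mirror_relations:
  fixes C :: "('o, 'm, 'k::field) supercat"
  assumes val: "valuation C (gen_sig (p_sign P')) ob \<phi>"
    and R: "\<And>f g. (f, g) \<in> relations P' \<Longrightarrow> teval C ob \<phi> f = teval C ob \<phi> g"
    and m: "mirrored \<sigma> P P'" and fg: "(f, g) \<in> relations P"
  shows "teval (monoidal_op C) ob (scale_A C \<sigma> \<phi>) f =
    teval (monoidal_op C) ob (scale_A C \<sigma> \<phi>) g"
proof -
  interpret valuation C "gen_sig (p_sign P')" ob \<phi> by (rule val)
  note ob = ob_add[symmetric]
  have [simp]: "TnsO C (ob 2) (ob (Suc 0)) = ob 3" "TnsO C (ob (Suc 0)) (ob 2) = ob 3"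
    "TnsO C (ob 0) (ob (Suc 0)) = ob (Suc 0)" "TnsO C (ob (Suc 0)) (ob 0) = ob (Suc 0)"
    by (simp_all add: ob numeral_3_eq_3)
  define H G A U I s where defs: "H = \<phi> gH" "G = \<phi> gHinv" "A = \<phi> gA" "U = \<phi> gU"
    "I = Ide C (ob (Suc 0))" "s = p_sign P'"
  have H [simp]: "H \<in> Arr C" "Src C H = ob 2" "Tgt C H = ob 2" "Par C H = 0"
    and G [simp]: "G \<in> Arr C" "Src C G = ob 2" "Tgt C G = ob 2" "Par C G = 0"
    and A [simp]: "A \<in> Arr C" "Src C A = ob 2" "Tgt C A = ob 0" "Par C A = s"
    and U [simp]: "U \<in> Arr C" "Src C U = ob 0" "Tgt C U = ob 2" "Par C U = s"
    and I [simp]: "I \<in> Arr C" "Src C I = ob (Suc 0)" "Tgt C I = ob (Suc 0)" "Par C I = 0"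
    using gen_in[of gH] gen_in[of gHinv] gen_in[of gA] gen_in[of gU]
    by (simp_all add: defs gen_sig_def Hom_def)
  have all: "\<forall>(f, g) \<in> relations P'. teval C ob \<phi> f = teval C ob \<phi> g"
    using R by blast
  let ?H1 = "Tns C H I" and ?H2 = "Tns C I H"
  let ?u = "Tns C U I" and ?w = "Tns C I U" and ?x = "Tns C A I" and ?z = "Tns C I A"
  let ?v = "Cmp C ?H2 ?u" and ?y = "Cmp C ?x ?H2"
  have ss [simp]: "s + s = 0" by (cases s) simp_all
  have uvw [simp]: "par ?u ?v" "par ?u ?w" and xyz [simp]: "par ?x ?y" "par ?x ?z"
    by (simp_all add: par_def)
  have e: "p_e P' = 1" "p_e' P' = 1" using m by (simp_all add: mirrored_def)
  have rel: "Cmp C H G = Ide C (ob 2)" "Cmp C G H = Ide C (ob 2)"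
    "Cmp C H U = Scl C (p_lam P') U" "Cmp C A H = Scl C (p_lam' P') A"
    "Cmp C A U = Scl C (p_delta P') (Ide C (ob 0))"
    "Cmp C ?x ?w = Scl C (p_vs P') I" "Cmp C ?z ?u = Scl C (p_vs' P') I"
    "Cmp C H H = lc (Ide C (ob 2)) H (Cmp C U A) (p_a P') (p_b P') (p_c P')"
    "Cmp C ?H1 ?w = lc ?u ?v ?w (p_d P') 1 (p_f P')"
    "Cmp C ?z ?H1 = lc ?x ?y ?z (p_d' P') 1 (p_f' P')"
    "Cmp C ?H1 (Cmp C ?H2 ?H1) = Cmp C ?H2 (Cmp C ?H1 ?H2)"
    using all unfolding relations_def defs[symmetric]
    by (simp_all add: defs[symmetric] lc_def e)
  have I_Cmp [simp]: "f \<in> Arr C \<Longrightarrow> Src C f = ob (Suc 0) \<Longrightarrow> Cmp C f I = f"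
    "f \<in> Arr C \<Longrightarrow> Tgt C f = ob (Suc 0) \<Longrightarrow> Cmp C I f = f" for f
    by (simp_all add: defs(5) arr_Cmp_Ide)
  have I_Id: "Tns C I (Ide C (ob 2)) = Ide C (ob 3)"
    by (simp add: defs(5) Tns_Ide)
  have whisker: "Cmp C (Tns C I f) (Tns C I g) = Tns C I (Cmp C f g)"
    if "f \<in> Arr C" "g \<in> Arr C" "Src C f = Tgt C g" for f g
    using that by (simp add: defs(5) Tns_Ide_Cmp)
  have id_H_UA [simp]: "par (Ide C (ob 2)) H" "par (Ide C (ob 2)) (Cmp C U A)"
    by (simp_all add: par_def)
  \<comment> \<open>The quadratic relation tensored with \<open>I\<close> on the left; its term in
    \<open>U A\<close> becomes the composite of \<open>?w\<close> and \<open>?z\<close>.\<close>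
  have H2H2: "Cmp C ?H2 ?H2 = lc (Ide C (ob 3)) ?H2 (Cmp C ?w ?z) (p_a P') (p_b P') (p_c P')"
    by (simp add: whisker rel lc_Tns I_Id)
  have par_H2 [simp]: "par (Ide C (ob 3)) ?H2" "par (Ide C (ob 3)) (Cmp C ?w ?z)"
    by (simp_all add: par_def)

  define L where "L k l m = lc ?u ?v ?w k l m" for k l m
  have L_add: "Add C (L k l m) (L k' l' m') = L (k + k') (l + l') (m + m')"
    and L_scl: "Scl C q (L k l m) = L (q * k) (q * l) (q * m)" for k l m k' l' m' q
    by (simp_all add: L_def lc_Add lc_Scl)
  (* The second equation takes this form because the first one rewrites inside ?v. *)
  have L_units: "?u = L 1 0 0" "Cmp C ?H2 (L 1 0 0) = L 0 1 0" "?w = L 0 0 1"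
    by (simp_all add: L_def lc_units)
  \<comment> \<open>Applying \<open>?H2\<close> to \<open>?v\<close> produces its square on
    \<open>?u\<close>. The term through \<open>?z\<close> then straightens by
    \<open>?z ?u = \<varsigma>' I\<close>, hence the factor \<open>p_vs' P'\<close>.\<close>
  have "Cmp C ?H2 ?v = Cmp C (Cmp C ?H2 ?H2) ?u"
    by (simp add: arr_Cmp_assoc)
  also have "\<dots> = lc ?u ?v (Scl C (p_vs' P') ?w) (p_a P') (p_b P') (p_c P')"
    unfolding H2H2 by (simp add: lc_Cmp arr_Cmp_assoc arr_Cmp_Ide arr_linear rel)
  finally have H2v: "Cmp C ?H2 ?v = L (p_a P') (p_b P') (p_c P' * p_vs' P')"
    by (simp add: lc_def L_units L_scl L_add)
  have H2w: "Cmp C ?H2 ?w = L 0 0 (p_lam P')"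
    by (simp add: whisker rel arr_linear) (simp add: L_units L_scl)
  \<comment> \<open>Reversal exchanges \<open>?H1 ?w\<close> with \<open>?v\<close> and
    \<open>?u\<close> with \<open>?w\<close>. As \<open>?v\<close> has coefficient 1 here, solving
    for it gives the reflected relation, with d and f replaced by -f and -d.\<close>
  have mirror_d: "Cmp C ?H1 ?w = L (p_d P') 1 (p_f P')"
    using rel(9) by (simp add: L_def)
  \<comment> \<open>This composite is the reflection of (H \<otimes> I)(I \<otimes> H)(U \<otimes>
    I); it is found by applying \<open>?H2\<close> to the three terms of
    \<open>rel(9)\<close>.\<close>
  have mirror_D: "Cmp C ?H2 (Cmp C ?H1 ?w) =
      L (p_a P') (p_d P' + p_b P') (p_c P' * p_vs' P' + p_f P' * p_lam P')"
    unfolding rel(9) using H2v H2w by (simp add: lc_Cmp)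
      (simp add: lc_def L_units L_scl L_add add_ac)
  have "Cmp C ?z ?v = Cmp C (Cmp C ?z ?H2) ?u"
    by (simp add: arr_Cmp_assoc)
  also have "\<dots> = Scl C (p_lam' P' * p_vs' P') I"
    by (simp add: whisker rel arr_linear arr_Cmp_assoc arr_Cmp_Ide)
  finally have "Cmp C ?z ?v = Scl C (p_lam' P' * p_vs' P') I" .
  moreover have "Cmp C ?z ?w = Scl C (p_delta P') I"
    by (simp add: whisker rel arr_linear arr_Cmp_assoc arr_Cmp_Ide) (simp add: defs(5) Tns_Ide ob)
  \<comment> \<open>The reflection of the \<rho> relation, up to the factor \<sigma>: the cap
    \<open>?z\<close> is applied to each term of \<open>rel(9)\<close>.\<close>
  ultimately have mirror_rho: "Cmp C ?z (Cmp C ?H1 ?w) =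
      Scl C ((p_d P' + p_lam' P') * p_vs' P' + p_f P' * p_delta P') I"
    unfolding rel(9)
    by (simp add: lc_Cmp)
      (simp add: lc_def rel arr_Scl_plus[symmetric] arr_Scl_mult[symmetric] algebra_simps)

  define M where "M k l m = lc ?x ?y ?z k l m" for k l m
  have M_add: "Add C (M k l m) (M k' l' m') = M (k + k') (l + l') (m + m')"
    and M_scl: "Scl C q (M k l m) = M (q * k) (q * l) (q * m)" for k l m k' l' m' q
    by (simp_all add: M_def lc_Add lc_Scl)
  have M_units: "?x = M 1 0 0" "Cmp C (M 1 0 0) ?H2 = M 0 1 0" "?z = M 0 0 1"
    by (simp_all add: M_def lc_units)
  \<comment> \<open>The dual computation for caps: here the term in \<open>U A\<close> straightens
    through \<open>?x ?w = \<varsigma> I\<close>, so \<varsigma> replaces \<varsigma>'.\<close>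
  have "Cmp C ?y ?H2 = Cmp C ?x (Cmp C ?H2 ?H2)"
    by (simp add: arr_Cmp_assoc)
  also have "\<dots> = lc ?x ?y (Cmp C (Cmp C ?x ?w) ?z) (p_a P') (p_b P') (p_c P')"
    unfolding H2H2 by (simp add: lc_Cmp arr_Cmp_assoc arr_Cmp_Ide arr_linear)
  finally have yH2: "Cmp C ?y ?H2 = M (p_a P') (p_b P') (p_c P' * p_vs P')"
    by (simp add: rel arr_linear arr_Cmp_assoc arr_Cmp_Ide) (simp add: lc_def M_units M_scl M_add)
  have zH2: "Cmp C ?z ?H2 = M 0 0 (p_lam' P')"
    by (simp add: whisker rel arr_linear) (simp add: M_units M_scl)
  have mirror_d': "Cmp C ?z ?H1 = M (p_d' P') 1 (p_f' P')"
    using rel(10) by (simp add: M_def)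
  have "Cmp C ?z (Cmp C ?H1 ?H2) = Cmp C (Cmp C ?z ?H1) ?H2"
    by (simp add: arr_Cmp_assoc)
  then have mirror_D': "Cmp C ?z (Cmp C ?H1 ?H2) =
      M (p_a P') (p_d' P' + p_b P') (p_c P' * p_vs P' + p_f' P' * p_lam' P')"
    unfolding rel(10) using yH2 zH2 by (simp add: lc_Cmp)
      (simp add: lc_def M_units M_scl M_add add_ac)

  \<comment> \<open>Every tensor product in the relations has \<open>I\<close> as a factor, so no
    Koszul sign survives. The factor \<sigma> cancels where \<open>A\<close> occurs on both sides;
    it remains in \<delta>, \<varsigma>, \<varsigma>', \<rho> and c.\<close>
  have "\<forall>(f, g) \<in> relations P. teval (monoidal_op C) ob (scale_A C \<sigma> \<phi>) f =
    teval (monoidal_op C) ob (scale_A C \<sigma> \<phi>) g"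
    unfolding relations_def using m
    apply (simp add: mirrored_def Tns_monoidal_op scale_A_def defs[symmetric])
    apply (simp add: monoidal_op_def arr_linear rel(1-8))
    (* The left-hand sides of mirror_d and mirror_d' occur inside these, so they must wait. *)
    apply (simp only: mirror_D mirror_D' mirror_rho)
    apply (simp add: rel(11) mirror_d mirror_d')
    apply (simp add: lc_def L_units M_units L_scl L_add M_scl M_add)
    apply (simp add: arr_Scl_mult[symmetric] algebra_simps)
    done
  then show ?thesis using fg by blast
qed

section \<open>Reflection functors between presented categories and their composites\<close>

lemma valuation_presented: "valuation (presented S R) S (\<lambda>n. n) (\<lambda>x. cls S R (TGen x))"
proof -
  interpret strict_monoidal_supercategory "presented S R" by (rule presented_supercategory)
  show ?thesis by unfold_locales (simp_all add: presented_simps cls_in_Hom)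
qed

text \<open>Evaluation in the tautological model is the quotient map, so a presented category is a
  model of its own relations and \<open>mirror_relations\<close> applies to it.\<close>

lemma teval_presented:
  "wt S f \<Longrightarrow> teval (presented S R) (\<lambda>n. n) (\<lambda>x. cls S R (TGen x)) f = cls S R f"
  by (induction f) (simp_all add: presented_simps Cmp_cls Tns_cls Add_cls Scl_cls)

text \<open>Two reversals restore the order of the factors, and the sign
  \<open>ksign (p * q)\<close> occurs twice and cancels.\<close>

lemma superfunctor_comp_op:
  assumes F: "strict_monoidal_superfunctor C (monoidal_op D) Fo Fm"
    and G: "strict_monoidal_superfunctor D (monoidal_op E) Go Gm"
    and E: "strict_monoidal_supercategory E"
  shows "strict_monoidal_superfunctor C E (\<lambda>x. Go (Fo x)) (\<lambda>f. Gm (Fm f))"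
proof -
  interpret F: strict_monoidal_superfunctor C "monoidal_op D" Fo Fm by (rule F)
  interpret G: strict_monoidal_superfunctor D "monoidal_op E" Go Gm by (rule G)
  interpret E: strict_monoidal_supercategory E by (rule E)
  have F_in: "Fm f \<in> Hom D (Fo x) (Fo y) p" if "f \<in> Hom C x y p" for f x y p
    using F.Fm_in[OF that] by simp
  have G_in: "Gm f \<in> Hom E (Go x) (Go y) p" if "f \<in> Hom D x y p" for f x y p
    using G.Fm_in[OF that] by simp
  show ?thesis
  proof unfold_locales
    fix f x y p g x' y' q assume fg: "f \<in> Hom C x y p" "g \<in> Hom C x' y' q"
    note F_fg = fg[THEN F_in]
    note GF_fg = F_fg[THEN G_in]
    have "Gm (Fm (Tns C f g)) = Gm (Scl D (ksign (p * q)) (Tns D (Fm g) (Fm f)))"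
      by (simp add: F.Fm_Tns[OF fg] Tns_monoidal_op[OF F_fg])
    also have "\<dots> = Scl E (ksign (p * q)) (Gm (Tns D (Fm g) (Fm f)))"
      using G.Fm_Scl[OF G.C.Tns_in[OF F_fg(2,1)]] by simp
    also have "\<dots> = Scl E (ksign (p * q) * ksign (q * p)) (Tns E (Gm (Fm f)) (Gm (Fm g)))"
      by (simp add: G.Fm_Tns[OF F_fg(2,1)] Tns_monoidal_op[OF GF_fg(2,1)]
          E.Scl_Scl[OF E.Tns_in[OF GF_fg]])
    also have "\<dots> = Tns E (Gm (Fm f)) (Gm (Fm g))"
      by (cases p; cases q) (simp_all add: ksign_def E.Scl_1[OF E.Tns_in[OF GF_fg]])
    finally show "Gm (Fm (Tns C f g)) = Tns E (Gm (Fm f)) (Gm (Fm g))" .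
  next
    show "f \<in> Hom C x y p \<Longrightarrow> Gm (Fm f) \<in> Hom E (Go (Fo x)) (Go (Fo y)) p" for f x y p
      by (intro G_in F_in)
    show "f \<in> Hom C x y p \<Longrightarrow> g \<in> Hom C x y p \<Longrightarrow>
        Gm (Fm (Add C f g)) = Add E (Gm (Fm f)) (Gm (Fm g))" for f g x y p
      using G.Fm_Add[OF F_in F_in, of f x y p g] F.Fm_Add[of f x y p g] by simp
    show "f \<in> Hom C x y p \<Longrightarrow> Gm (Fm (Scl C k f)) = Scl E k (Gm (Fm f))" for f x y p k
      using G.Fm_Scl[OF F_in, of f x y p k] F.Fm_Scl[of f x y p k] by simp
    show "Gm (Fm (Ide C x)) = Ide E (Go (Fo x))" for x
      using G.Fm_Ide[of "Fo x"] F.Fm_Ide[of x] by simp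
    show "f \<in> Hom C y z p \<Longrightarrow> g \<in> Hom C x y q \<Longrightarrow>
        Gm (Fm (Cmp C f g)) = Cmp E (Gm (Fm f)) (Gm (Fm g))" for f y z p g x q
      using G.Fm_Cmp[OF F_in F_in, of f y z p g x q] F.Fm_Cmp[of f y z p g x q] by simp
    show "Go (Fo (UntO C)) = UntO E"
      using F.Fo_unit G.Fo_unit by simp
    show "Go (Fo (TnsO C x y)) = TnsO E (Go (Fo x)) (Go (Fo y))" for x y
      using F.Fo_TnsO[of x y] G.Fo_TnsO[of "Fo y" "Fo x"] by simp
  qed
qed

text \<open>Every arrow is the class of a term, so a functor is determined by its values on the
  generators.\<close>

lemma presented_endofunctor_id:
  assumes F: "strict_monoidal_superfunctor (presented S R) (presented S R) (\<lambda>n. n) Fm"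
    and gen: "\<And>x. Fm (cls S R (TGen x)) = cls S R (TGen x)"
    and W: "W \<in> Hom (presented S R) m n p"
  shows "Fm W = W"
proof -
  interpret F: strict_monoidal_superfunctor "presented S R" "presented S R" "\<lambda>n. n" Fm by (rule F)
  have in_Hom: "cls S R f \<in> Hom (presented S R) (tdom S f) (tcod S f) (tpar S f)"
    if "wt S f" for f
    using that by (simp add: cls_in_Hom)
  have "Fm (cls S R f) = cls S R f" if "wt S f" for f
    using that
  proof (induction f)
    case (TId m)
    then show ?case using F.Fm_Ide[of m] by (simp add: presented_simps)
  next
    case (TZero m n p)
    let ?Z = "Zer (presented S R) m n p"
    \<comment> \<open>Preservation of zero arrows is not an axiom of superfunctors; it follows from
      linearity, as zero is its own multiple by 0.\<close>
    have "Fm (Scl (presented S R) 0 ?Z) = Scl (presented S R) 0 (Fm ?Z)"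
      by (rule F.Fm_Scl[OF F.C.Zer_in])
    then have "Fm ?Z = ?Z"
      by (simp add: F.C.Scl_0[OF F.C.Zer_in] F.C.Scl_0[OF F.Fm_in[OF F.C.Zer_in]])
    then show ?case by (simp add: presented_simps)
  next
    case (TCmp f g)
    then show ?case
      using F.Fm_Cmp[OF in_Hom[of f], of "cls S R g" "tdom S g" "tpar S g"] in_Hom[of g]
      by (simp add: Cmp_cls)
  next
    case (TTns f g)
    then show ?case using F.Fm_Tns[OF in_Hom[of f] in_Hom[of g]] by (simp add: Tns_cls)
  next
    case (TAdd f g)
    then show ?case
      using F.Fm_Add[OF in_Hom[of f], of "cls S R g"] in_Hom[of g]
      by (simp add: Add_cls parallel_def)
  next
    case (TScl k f)
    then show ?case using F.Fm_Scl[OF in_Hom[of f], of k] by (simp add: Scl_cls)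
  qed (simp add: gen)
  with W show ?thesis by (auto elim: Hom_presentedE)
qed

text \<open>The universal property, applied to the reflected tautological model of
  \<open>P'\<close>. The values on generators are recorded in order to identify the inverse.\<close>

lemma mirror_superfunctor:
  fixes P P' :: "'k::field params"
  assumes m: "mirrored \<sigma> P P'"
  obtains Fm where
    "strict_monoidal_superfunctor (supercat_of P) (monoidal_op (supercat_of P')) (\<lambda>n. n) Fm"
    "\<And>x. Fm (cls (gen_sig (p_sign P)) (relations P) (TGen x)) =
      scale_A (supercat_of P') \<sigma> (\<lambda>x. cls (gen_sig (p_sign P')) (relations P') (TGen x)) x"
proof -
  let ?S = "gen_sig (p_sign P')" and ?R = "relations P'"
  let ?\<phi> = "\<lambda>x. cls ?S ?R (TGen x)"
  have val: "valuation (supercat_of P') ?S (\<lambda>n. n) ?\<phi>"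
    unfolding supercat_of_def by (rule valuation_presented)
  have rels: "teval (supercat_of P') (\<lambda>n. n) ?\<phi> f = teval (supercat_of P') (\<lambda>n. n) ?\<phi> g"
    if "(f, g) \<in> ?R" for f g
  proof -
    have "cls ?S ?R f = cls ?S ?R g"
      using that by (intro cls_eqI trm_eq.rel relations_wt)
    then show ?thesis
      using relations_wt[OF that] by (simp add: supercat_of_def teval_presented)
  qed
  have sgn: "p_sign P = p_sign P'" using m by (simp add: mirrored_def)
  interpret valuation "monoidal_op (supercat_of P')" ?S "\<lambda>n. n" "scale_A (supercat_of P') \<sigma> ?\<phi>"
    by (rule valuation_mirror[OF val])
  note F = superfunctor[OF mirror_relations[OF val rels m]]
  show thesis
  proof (rule that)
    show "strict_monoidal_superfunctor (supercat_of P) (monoidal_op (supercat_of P')) (\<lambda>n. n)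
        (\<lambda>W. ev (rep W))"
      using F(1) by (simp add: supercat_of_def sgn)
    show "ev (rep (cls (gen_sig (p_sign P)) (relations P) (TGen x))) =
        scale_A (supercat_of P') \<sigma> ?\<phi> x" for x
      using F(2)[where f = "TGen x"] by (simp add: sgn)
  qed
qed

text \<open>The composite fixes \<open>H\<close>, its inverse and \<open>U\<close>, and multiplies
  \<open>A\<close> by \<sigma>\<tau> = 1; hence it is the identity.\<close>

lemma mirror_comp:
  fixes P P' :: "'k::field params"
  assumes F: "strict_monoidal_superfunctor (supercat_of P) (monoidal_op (supercat_of P')) (\<lambda>n. n) Fm"
    and F_gen: "\<And>x. Fm (cls (gen_sig (p_sign P)) (relations P) (TGen x)) =
      scale_A (supercat_of P') \<sigma> (\<lambda>x. cls (gen_sig (p_sign P')) (relations P') (TGen x)) x"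
    and G: "strict_monoidal_superfunctor (supercat_of P') (monoidal_op (supercat_of P)) (\<lambda>n. n) Gm"
    and G_gen: "\<And>x. Gm (cls (gen_sig (p_sign P')) (relations P') (TGen x)) =
      scale_A (supercat_of P) \<tau> (\<lambda>x. cls (gen_sig (p_sign P)) (relations P) (TGen x)) x"
    and "\<sigma> * \<tau> = 1" and W: "W \<in> Hom (supercat_of P) m n p"
  shows "Gm (Fm W) = W"
proof -
  interpret P: strict_monoidal_supercategory "supercat_of P"
    unfolding supercat_of_def by (rule presented_supercategory)
  interpret G: strict_monoidal_superfunctor "supercat_of P'" "monoidal_op (supercat_of P)" "\<lambda>n. n" Gm
    by (rule G)
  have cls_in: "cls (gen_sig (p_sign Q)) (relations Q) (TGen gA) \<in> Hom (supercat_of Q) 2 0 (p_sign Q)"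
    for Q :: "'k params"
    unfolding supercat_of_def by (rule cls_in_Hom) (simp_all add: gen_sig_def)
  have "Gm (Fm (cls (gen_sig (p_sign P)) (relations P) (TGen x))) =
      cls (gen_sig (p_sign P)) (relations P) (TGen x)" for x
    using G.Fm_Scl[OF cls_in, of \<sigma>] \<open>\<sigma> * \<tau> = 1\<close>
    by (simp add: F_gen G_gen scale_A_def P.Scl_Scl[OF cls_in] P.Scl_1[OF cls_in])
  then show ?thesis
    using superfunctor_comp_op[OF F G P.strict_monoidal_supercategory_axioms] W
      presented_endofunctor_id[where Fm = "\<lambda>W. Gm (Fm W)"]
    unfolding supercat_of_def by blast
qed

lemma mirrored_imp_isomorphic:
  assumes "mirrored \<sigma> P P'" "mirrored \<tau> P' P" "\<sigma> * \<tau> = 1"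
  shows "supercat_of P \<cong>\<^sub>s monoidal_op (supercat_of P')"
proof -
  obtain Fm where F:
    "strict_monoidal_superfunctor (supercat_of P) (monoidal_op (supercat_of P')) (\<lambda>n. n) Fm"
    "\<And>x. Fm (cls (gen_sig (p_sign P)) (relations P) (TGen x)) =
      scale_A (supercat_of P') \<sigma> (\<lambda>x. cls (gen_sig (p_sign P')) (relations P') (TGen x)) x"
    using mirror_superfunctor[OF assms(1)] by blast
  obtain Gm where G:
    "strict_monoidal_superfunctor (supercat_of P') (monoidal_op (supercat_of P)) (\<lambda>n. n) Gm"
    "\<And>x. Gm (cls (gen_sig (p_sign P')) (relations P') (TGen x)) =
      scale_A (supercat_of P) \<tau> (\<lambda>x. cls (gen_sig (p_sign P)) (relations P) (TGen x)) x"
    using mirror_superfunctor[OF assms(2)] by blast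
  interpret F: strict_monoidal_superfunctor "supercat_of P" "monoidal_op (supercat_of P')" "\<lambda>n. n" Fm
    by (rule F)
  interpret G: strict_monoidal_superfunctor "supercat_of P'" "monoidal_op (supercat_of P)" "\<lambda>n. n" Gm
    by (rule G)
  have "bij_betw Fm (Hom (supercat_of P) x y p) (Hom (supercat_of P') x y p)" for x y p
    \<comment> \<open>Applying the lemma in both orders shows that \<open>Fm\<close> and
      \<open>Gm\<close> are mutually inverse on every morphism space.\<close>
    using mirror_comp[OF F G assms(3)] mirror_comp[OF G F, unfolded mult.commute[of \<tau>], OF assms(3)]
      F.Fm_in G.Fm_in
    by (intro bij_betw_byWitness[where f' = Gm]) auto
  then show ?thesis
    unfolding isomorphic_supercat_def using F(1)
    by (intro exI[of _ "\<lambda>n. n"] exI[of _ Fm]) (simp add: bij_id[unfolded id_def])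
qed

section \<open>The five families of parameters\<close>

theorem corollary9p4:
  fixes b lam vs delta :: "'k::field"
  assumes "CHAR('k) \<noteq> 2" and "lam \<noteq> 0" and "vs \<noteq> 0"
  shows
    "(b \<noteq> 0 \<and> lam^2 - b * lam + b * lam * delta / vs \<noteq> 0 \<longrightarrow>
        supercat_of (params_bb_plus b lam vs delta)
          \<cong>\<^sub>s monoidal_op (supercat_of (params_bb_plus b lam vs delta))) \<and>
     (lam^2 \<noteq> 0 \<longrightarrow>
        supercat_of (params_00_plus lam vs delta)
          \<cong>\<^sub>s monoidal_op (supercat_of (params_00_plus lam vs delta))) \<and>
     (lam^2 \<noteq> 0 \<longrightarrow>
        supercat_of (params_00_minus lam vs)
          \<cong>\<^sub>s monoidal_op (supercat_of (params_00_minus lam vs))) \<and>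
     (b \<noteq> 0 \<and> lam^2 - b * lam \<noteq> 0 \<longrightarrow>
        supercat_of (params_b0_minus b lam vs)
          \<cong>\<^sub>s monoidal_op (supercat_of (params_0b_minus b lam vs)) \<and>
        supercat_of (params_0b_minus b lam vs)
          \<cong>\<^sub>s monoidal_op (supercat_of (params_b0_minus b lam vs)))"
proof (intro conjI impI)
  show "supercat_of (params_bb_plus b lam vs delta)
      \<cong>\<^sub>s monoidal_op (supercat_of (params_bb_plus b lam vs delta))"
    \<comment> \<open>For even \<open>A\<close> and \<open>U\<close> one has \<varsigma>' =
      \<varsigma>, which is nonzero, so \<sigma> = 1 is forced.\<close>
    by (rule mirrored_imp_isomorphic[of 1 _ _ 1])
      (use assms in \<open>simp_all add: mirrored_def params_bb_plus_def field_simps\<close>)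
  show "supercat_of (params_00_plus lam vs delta)
      \<cong>\<^sub>s monoidal_op (supercat_of (params_00_plus lam vs delta))"
    by (rule mirrored_imp_isomorphic[of 1 _ _ 1])
      (simp_all add: mirrored_def params_00_plus_def)
  show "supercat_of (params_00_minus lam vs)
      \<cong>\<^sub>s monoidal_op (supercat_of (params_00_minus lam vs))"
    \<comment> \<open>In the odd case \<varsigma>' = -\<varsigma>, whence \<sigma> = -1.\<close>
    by (rule mirrored_imp_isomorphic[of "- 1" _ _ "- 1"])
      (simp_all add: mirrored_def params_00_minus_def)
  \<comment> \<open>Exchanging (d, f) with (-f, -d), and likewise the primed pair, carries the
    coefficients of one family to those of the other.\<close>
  have "mirrored (- 1) (params_b0_minus b lam vs) (params_0b_minus b lam vs)"
    "mirrored (- 1) (params_0b_minus b lam vs) (params_b0_minus b lam vs)"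
    by (simp_all add: mirrored_def params_b0_minus_def params_0b_minus_def algebra_simps)
  then show "supercat_of (params_b0_minus b lam vs)
      \<cong>\<^sub>s monoidal_op (supercat_of (params_0b_minus b lam vs))"
    "supercat_of (params_0b_minus b lam vs)
      \<cong>\<^sub>s monoidal_op (supercat_of (params_b0_minus b lam vs))"
    by (simp_all add: mirrored_imp_isomorphic[of "- 1" _ _ "- 1"])
qed

end
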